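(* Let $(Y_n,\Gamma_n)_{n\in\mathbb{N}_0}$, $Y_n=(X_n,\phi_n)$, be an AIR MCMC chain with parameter $\beta>0$ in the setting described in the context. Assume that there exist a set $C\in\mathcal{F}_\mathcal{Y}$, a lower semi-continuous measurable function $V\colon\mathcal{Y}\to[1,\infty)$ and numbers $\kappa\in(0,1)$, $\delta>0$, $b<\infty$ such that $\sup_{x\in C}V(x)=v<\infty$ and, for every $\gamma\in\mathcal{I}$: (i) $P_\gamma V(y)\le\kappa V(y)+b\,\mathds{1}_C(y)$ for all $y\in\mathcal{Y}$; (ii) there exists a probability measure $\eta_\gamma$ on $C$ such that $P_\gamma(x,A)\ge\delta\,\eta_\gamma(A\cap C)$ for all $x\in C$ and all $A\in\mathcal{F}_\mathcal{Y}$. Let $p>2$ and let $f\colon\mathcal{X}\to\mathbb{R}$ be a measurable function such that $h=h_f\colon\mathcal{Y}\to\mathbb{R}$, $h(x,\phi)=f(x)$, satisfies $|h|\le V^{1/p}$. Then for every $\varepsilon>\max\bigl\{0,\frac{1}{1+\beta}+\frac1p-\frac12\bigr\}$, almost surely, $$\lim_{n\to\infty}\frac{1}{n^{1/2+\varepsilon}}\sum_{j=1}^n\bigl(f(X_j)-\nu(f)\bigr)=0 .$$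
   Context: Setting. $(\mathcal{X},\mathcal{F}_\mathcal{X},\nu)$ is a probability space, $(\Phi,\mathcal{F}_\Phi)$ is a measurable space, and $\mathcal{Y}=\mathcal{X}\times\Phi$ with $\mathcal{F}_\mathcal{Y}=\mathcal{F}_\mathcal{X}\otimes\mathcal{F}_\Phi$; these are Polish spaces with their (countably generated) Borel $\sigma$-algebras, and $d_\mathcal{Y}$ denotes a metric inducing the Polish topology of $\mathcal{Y}$ (semi-continuity refers to it). $(\mathcal{I},\mathcal{F}_\mathcal{I})$ is a measurable space. $\{\pi_\gamma\}_{\gamma\in\mathcal{I}}$ is a family of probability measures on $\mathcal{Y}$ and $\{P_\gamma\}_{\gamma\in\mathcal{I}}$ a family of transition kernels on $\mathcal{Y}$ such that for every $\gamma$: $\pi_\gamma(B\times\Phi)=\nu(B)$ for all $B\in\mathcal{F}_\mathcal{X}$; $\pi_\gamma$ is the invariant distribution of $P_\gamma$; $P_\gamma$ is $\psi$-irreducible and aperiodic. Moreover $(y,\gamma)\mapsto P_\gamma(y,A)$ is measurable for every $A\in\mathcal{F}_\mathcal{Y}$. Write $\nu(f)=\int f\,d\nu$ and $P_\gamma V(y)=\int V(y')\,P_\gamma(y,dy')$. AIR MCMC chain with parameter $\beta>0$. Put $k_j=\lceil j^\beta\rceil$, $T_0=0$, $T_m=\sum_{j=1}^m k_j$. The chain is a process $(Y_n,\Gamma_n)_{n\in\mathbb{N}_0}$ on a probability space $(\Omega,\mathcal{F},\mathbb{P})$ with values in $\mathcal{Y}\times\mathcal{I}$ such that: $(Y_0,\Gamma_0)=(y_0,\gamma_0)$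 is deterministic; with $\mathcal{F}_n=\sigma(Y_0,\dots,Y_n,\Gamma_0,\dots,\Gamma_n)$ one has $\mathbb{P}[Y_{n+1}\in B\mid\mathcal{F}_n]=P_{\Gamma_n}(Y_n,B)$ a.s. for all $B\in\mathcal{F}_\mathcal{Y}$; $\Gamma_n=U_n(Y_0,\dots,Y_n,\Gamma_0,\dots,\Gamma_{n-1})$ for measurable maps $U_n\colon\mathcal{Y}^{n+1}\times\mathcal{I}^n\to\mathcal{I}$; adaptation happens only at the times $T_m$, i.e. $\Gamma_{i_1}=\Gamma_{i_2}$ whenever $i_1,i_2\in\{T_j,\dots,T_{j+1}-1\}$ for some $j$; and $\omega\mapsto\pi_{\Gamma_n(\omega)}(g)$ is measurable for every measurable $g\colon\mathcal{Y}\to\mathbb{R}$ with $\pi_\gamma(|g|)<\infty$ for all $\gamma$. Write $Y_n=(X_n,\phi_n)$ with $X_n\in\mathcal{X}$, $\phi_n\in\Phi$. *)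

theory Defs
  imports "HOL-Probability.Probability"
begin

definition lower_semicontinuous :: "('a::topological_space \<Rightarrow> real) \<Rightarrow> bool" where
  "lower_semicontinuous V \<longleftrightarrow> (\<forall>y0. \<forall>c < V y0. eventually (\<lambda>y. c < V y) (nhds y0))"

section \<open>Transition kernels on a measurable space\<close>

text \<open>The set \<open>S \<rightarrow>\<^sub>M prob_algebra S\<close> consists of the Markov transition kernels on \<open>S\<close>.\<close>

primrec kernel_pow :: "'a measure \<Rightarrow> ('a \<Rightarrow> 'a measure) \<Rightarrow> nat \<Rightarrow> 'a \<Rightarrow> 'a measure" where
  "kernel_pow S K 0 y = return S y"
| "kernel_pow S K (Suc n) y = bind (K y) (kernel_pow S K n)"

definition invariant_distribution :: "'a measure \<Rightarrow> ('a \<Rightarrow> 'a measure) \<Rightarrow> 'a measure \<Rightarrow> bool" where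
  "invariant_distribution S K \<mu> \<longleftrightarrow>
     prob_space \<mu> \<and> sets \<mu> = sets S \<and>
     (\<forall>A\<in>sets S. (\<integral>\<^sup>+ y. emeasure (K y) A \<partial>\<mu>) = emeasure \<mu> A)"

text \<open>Irreducibility, cycles and aperiodicity follow Meyn and Tweedie,
  \<^emph>\<open>Markov Chains and Stochastic Stability\<close>: \<open>K\<close> is \<open>\<psi>\<close>-irreducible if \<open>\<psi>\<close> is a maximal
  irreducibility measure, and aperiodic if the largest \<open>d\<close> for which a \<open>d\<close>-cycle exists is 1.\<close>

definition irreducibility_measure :: "'a measure \<Rightarrow> ('a \<Rightarrow> 'a measure) \<Rightarrow> 'a measure \<Rightarrow> bool" where
  "irreducibility_measure S K \<phi> \<longleftrightarrow>
     sigma_finite_measure \<phi> \<and> sets \<phi> = sets S \<and> emeasure \<phi> (space S) > 0 \<and>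
     (\<forall>A\<in>sets S. emeasure \<phi> A > 0 \<longrightarrow>
        (\<forall>y\<in>space S. \<exists>n\<ge>1. emeasure (kernel_pow S K n y) A > 0))"

definition psi_irreducible :: "'a measure \<Rightarrow> ('a \<Rightarrow> 'a measure) \<Rightarrow> 'a measure \<Rightarrow> bool" where
  "psi_irreducible S K \<psi> \<longleftrightarrow>
     irreducibility_measure S K \<psi> \<and>
     (\<forall>\<phi>. irreducibility_measure S K \<phi> \<longrightarrow> absolutely_continuous \<psi> \<phi>)"

definition d_cycle ::
  "'a measure \<Rightarrow> ('a \<Rightarrow> 'a measure) \<Rightarrow> 'a measure \<Rightarrow> nat \<Rightarrow> (nat \<Rightarrow> 'a set) \<Rightarrow> bool" where
  "d_cycle S K \<psi> d D \<longleftrightarrow>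
     d \<ge> 1 \<and> (\<forall>i<d. D i \<in> sets S) \<and> disjoint_family_on D {..<d} \<and>
     (\<forall>i<d. \<forall>y\<in>D i. emeasure (K y) (D (Suc i mod d)) = 1) \<and>
     emeasure \<psi> (space S - (\<Union>i<d. D i)) = 0"

definition aperiodic :: "'a measure \<Rightarrow> ('a \<Rightarrow> 'a measure) \<Rightarrow> 'a measure \<Rightarrow> bool" where
  "aperiodic S K \<psi> \<longleftrightarrow> (\<forall>d D. d_cycle S K \<psi> d D \<longrightarrow> d = 1)"

section \<open>The AIR MCMC chain\<close>

text \<open>For second countable spaces the Borel sigma-algebra of the product type is the product of
  the Borel sigma-algebras (\<open>borel_prod\<close>).\<close>

locale mcmc_family =
  fixes \<nu> :: "'x::polish_space measure"
    and MI :: "'i measure"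
    and \<pi> :: "'i \<Rightarrow> ('x \<times> 'f::polish_space) measure"
    and P :: "'i \<Rightarrow> 'x \<times> 'f \<Rightarrow> ('x \<times> 'f) measure"
  assumes prob_nu: "prob_space \<nu>"
    and sets_nu: "sets \<nu> = sets borel"
    and kernel: "\<And>\<gamma>. \<gamma> \<in> space MI \<Longrightarrow> P \<gamma> \<in> borel \<rightarrow>\<^sub>M prob_algebra borel"
    and kernel_measurable:
      "\<And>A. A \<in> sets borel \<Longrightarrow>
         (\<lambda>(y, \<gamma>). emeasure (P \<gamma> y) A) \<in> borel_measurable (borel \<Otimes>\<^sub>M MI)"
    and invariant: "\<And>\<gamma>. \<gamma> \<in> space MI \<Longrightarrow> invariant_distribution borel (P \<gamma>) (\<pi> \<gamma>)"
    and marginal: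
      "\<And>\<gamma> B. \<gamma> \<in> space MI \<Longrightarrow> B \<in> sets borel \<Longrightarrow> emeasure (\<pi> \<gamma>) (B \<times> UNIV) = emeasure \<nu> B"
    and irreducible_aperiodic:
      "\<And>\<gamma>. \<gamma> \<in> space MI \<Longrightarrow>
         \<exists>\<psi>. psi_irreducible borel (P \<gamma>) \<psi> \<and> aperiodic borel (P \<gamma>) \<psi>"

definition air_lag :: "real \<Rightarrow> nat \<Rightarrow> nat" where
  "air_lag \<beta> j = nat \<lceil>real j powr \<beta>\<rceil>"

definition air_time :: "real \<Rightarrow> nat \<Rightarrow> nat" where
  "air_time \<beta> m = (\<Sum>j = 1..m. air_lag \<beta> j)"

definition history ::
  "'w measure \<Rightarrow> 'i measure \<Rightarrow> (nat \<Rightarrow> 'w \<Rightarrow> 'y::topological_space) \<Rightarrow> (nat \<Rightarrow> 'w \<Rightarrow> 'i)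
     \<Rightarrow> nat \<Rightarrow> 'w measure" where
  "history M MI Y \<Gamma> n = sigma (space M)
     ({Y i -` B \<inter> space M | i B. i \<le> n \<and> B \<in> sets borel} \<union>
      {\<Gamma> i -` B \<inter> space M | i B. i \<le> n \<and> B \<in> sets MI})"

locale air_mcmc = mcmc_family \<nu> MI \<pi> P
  for \<nu> :: "'x::polish_space measure"
    and MI :: "'i measure"
    and \<pi> :: "'i \<Rightarrow> ('x \<times> 'f::polish_space) measure"
    and P :: "'i \<Rightarrow> 'x \<times> 'f \<Rightarrow> ('x \<times> 'f) measure" +
  fixes \<beta> :: real
    and M :: "'w measure"
    and Y :: "nat \<Rightarrow> 'w \<Rightarrow> 'x \<times> 'f"
    and \<Gamma> :: "nat \<Rightarrow> 'w \<Rightarrow> 'i"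
  assumes beta_pos: "\<beta> > 0"
    and prob_M: "prob_space M"
    and Y_measurable: "\<And>n. Y n \<in> M \<rightarrow>\<^sub>M borel"
    and \<Gamma>_measurable: "\<And>n. \<Gamma> n \<in> M \<rightarrow>\<^sub>M MI"
    and start: "\<exists>y0 \<gamma>0. \<forall>\<omega>\<in>space M. Y 0 \<omega> = y0 \<and> \<Gamma> 0 \<omega> = \<gamma>0"
    and transition:
      "\<And>n B. B \<in> sets borel \<Longrightarrow>
         AE \<omega> in M. real_cond_exp M (history M MI Y \<Gamma> n) (indicator (Y (Suc n) -` B \<inter> space M)) \<omega>
           = measure (P (\<Gamma> n \<omega>) (Y n \<omega>)) B"
    and adaptation:
      "\<And>n. \<exists>U. U \<in> (\<Pi>\<^sub>M i\<in>{..n}. borel) \<Otimes>\<^sub>M (\<Pi>\<^sub>M i\<in>{..<n}. MI) \<rightarrow>\<^sub>M MI \<and>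
         (\<forall>\<omega>\<in>space M. \<Gamma> n \<omega> = U (\<lambda>i\<in>{..n}. Y i \<omega>, \<lambda>i\<in>{..<n}. \<Gamma> i \<omega>))"
    and adaptation_times:
      "\<And>j i1 i2 \<omega>. \<lbrakk>i1 \<in> {air_time \<beta> j..<air_time \<beta> (Suc j)};
          i2 \<in> {air_time \<beta> j..<air_time \<beta> (Suc j)}; \<omega> \<in> space M\<rbrakk> \<Longrightarrow> \<Gamma> i1 \<omega> = \<Gamma> i2 \<omega>"
    and integral_measurable:
      "\<And>(g :: _ \<Rightarrow> real) n. \<lbrakk>g \<in> borel_measurable borel; \<And>\<gamma>. \<gamma> \<in> space MI \<Longrightarrow> integrable (\<pi> \<gamma>) g\<rbrakk> \<Longrightarrow>
         (\<lambda>\<omega>. \<integral>y. g y \<partial>\<pi> (\<Gamma> n \<omega>)) \<in> borel_measurable M"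

end

theory Submission
  imports Defs
begin

text \<open>
  Since \<open>V \<ge> 1\<close> and \<open>p > 2\<close>, it suffices to work with \<open>W = sqrt V\<close>, which dominates \<open>f\<close> and
  inherits a drift condition by Jensen's inequality; \<open>E V(Y_n)\<close> is bounded in \<open>n\<close>.

  For fixed \<open>\<gamma>\<close>, subtracting the minorizing part gives \<open>Q u = P u - \<delta> 1_C \<eta>(u)\<close>, a strict
  contraction in the norm weighted by \<open>U = W + b / \<delta>\<close>, with a rate depending only on the constants
  of the drift and minorization conditions. If \<open>u\<close> has stationary mean 0, the Neumann series of \<open>Q\<close>
  solves the Poisson equation \<open>g - P g = u\<close>, because \<open>\<eta>(g) = 0\<close>. Hence the partial sums
  \<open>u + P u + \<dots> + P^(m-1) u = g - P^m g\<close> are bounded by a multiple of \<open>W\<close>, uniformly in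
  \<open>m\<close> and \<open>\<gamma>\<close>.

  The Cesaro means of these partial sums solve the Poisson equation up to an error of order \<open>W / N\<close>.
  With them the centred sum splits into a martingale with \<open>L^2\<close>-bounded increments, which is
  \<open>o(n^s)\<close> for every \<open>s > 1/2\<close>, an error of order \<open>\<Sum> W(Y_j) / j\<close>, and a sum that
  telescopes between adaptation times. What remains of the latter is \<open>\<Sum> W(Y_T)\<close> over the adaptation
  times \<open>T \<le> n\<close>; as \<open>T_m \<ge> m^(1+\<beta>) / (1+\<beta>)\<close>, it is \<open>o(n^s)\<close> once \<open>s (1 + \<beta>) > 1\<close>.
\<close>

section \<open>Kernels with drift and minorization\<close>

text \<open>No continuity of \<open>P \<gamma>\<close> in \<gamma> is assumed, so at an adaptation
  time the approximate solution of the Poisson equation can jump by anything of size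
  \<open>W\<close>. Such jumps cannot be made small; they can only be counted, and this is where the
  growth of the lags enters. Between adaptation times nothing jumps, provided that the horizon N of
  the Cesaro mean is frozen there as well.

  All constants have to be the same for every \<gamma>, although \<eta> and the invariant
  distribution vary with \<gamma>. This is why the contraction rate is computed explicitly, and why
  quantities such as the mass of \<open>C\<close> under the invariant distribution may occur only in
  terms that vanish in a limit.

  Partial sums of P^k u are estimated instead of single terms: they telescope, so a bound comes
  without a rate of convergence of P^k u. Since they are only known to be bounded, they are
  averaged: the residual of the averaged equation is again a partial sum, less u, divided by
  N.\<close>

lemma nn_integral_ge_of_minorization:
  assumes sets: "sets N = sets \<eta>" and le: "\<And>A. A \<in> sets \<eta> \<Longrightarrow> ennreal \<delta> * emeasure \<eta> A \<le> emeasure N A"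
    and u: "u \<in> borel_measurable \<eta>"
  shows "ennreal \<delta> * (\<integral>\<^sup>+x. u x \<partial>\<eta>) \<le> (\<integral>\<^sup>+x. u x \<partial>N)"
proof -
  have "ennreal \<delta> * (\<integral>\<^sup>+x. u x \<partial>\<eta>) = (\<integral>\<^sup>+x. u x \<partial>scale_measure (ennreal \<delta>) \<eta>)"
    using u by (simp add: nn_integral_scale_measure)
  also have "\<dots> \<le> (\<integral>\<^sup>+x. u x \<partial>N)"
    using le sets by (intro nn_integral_mono_measure) (auto simp: le_measure)
  finally show ?thesis .
qed

text \<open>Pushing \<open>L x\<close> forward along y -> (x, y) moves the parameter into the
  measure: the integrand on the product is then fixed, and only a kernel varies.\<close>

lemma integral_measurable_subprob_algebra2:
  fixes f :: "'a \<Rightarrow> 'b \<Rightarrow> real"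
  assumes f [measurable]: "(\<lambda>(x, y). f x y) \<in> borel_measurable (M \<Otimes>\<^sub>M N)"
    and L [measurable]: "L \<in> M \<rightarrow>\<^sub>M subprob_algebra N"
  shows "(\<lambda>x. \<integral>y. f x y \<partial>L x) \<in> borel_measurable M"
proof -
  note measurable_distr2[measurable]
  have "(\<lambda>x. \<integral>z. (case z of (x, y) \<Rightarrow> f x y) \<partial>distr (L x) (M \<Otimes>\<^sub>M N) (\<lambda>y. (x, y))) \<in> borel_measurable M"
    by (rule measurable_compose[OF _ integral_measurable_subprob_algebra[OF f]]) measurable
  then show ?thesis
    by (rule measurable_cong[THEN iffD1, rotated]) (simp add: integral_distr)
qed

section \<open>Weighted estimates for a single kernel\<close>

text \<open>The Bochner integral is 0 on non-integrable functions, so additivity and monotonicity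
  are available only where integrability is known; below this is the role of
  \<open>dominated\<close>.\<close>

definition kernel_op :: "('a \<Rightarrow> 'a measure) \<Rightarrow> ('a \<Rightarrow> real) \<Rightarrow> 'a \<Rightarrow> real" where
  "kernel_op K u y = (\<integral>y'. u y' \<partial>K y)"

text \<open>The drift is stated with the nonnegative integral and therefore entails integrability of
  \<open>W\<close>; a Bochner integral could satisfy it by its default value.\<close>

locale drift_minorization =
  fixes S :: "'a measure" and K :: "'a \<Rightarrow> 'a measure" and W :: "'a \<Rightarrow> real" and C :: "'a set"
    and l b \<delta> :: real and \<eta> :: "'a measure"
  assumes kernel: "K \<in> S \<rightarrow>\<^sub>M prob_algebra S"
    and W_measurable [measurable]: "W \<in> borel_measurable S"
    and W_ge_1: "\<And>y. y \<in> space S \<Longrightarrow> 1 \<le> W y"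
    and C_sets [measurable]: "C \<in> sets S"
    and l: "0 \<le> l" "l < 1"
    and b: "0 \<le> b"
    and \<delta>: "0 < \<delta>"
    and drift: "\<And>y. y \<in> space S \<Longrightarrow> (\<integral>\<^sup>+ y'. ennreal (W y') \<partial>K y) \<le> ennreal (l * W y + b * indicator C y)"
    and prob_\<eta>: "prob_space \<eta>"
    and sets_\<eta> [measurable_cong]: "sets \<eta> = sets S"
    and minorization: "\<And>y A. y \<in> C \<Longrightarrow> A \<in> sets S \<Longrightarrow> ennreal \<delta> * emeasure \<eta> A \<le> emeasure (K y) A"
begin

lemma sets_K [simp]: "y \<in> space S \<Longrightarrow> sets (K y) = sets S"
  using sets_kernel[OF measurable_prob_algebraD[OF kernel]] .

lemma space_K [simp]: "y \<in> space S \<Longrightarrow> space (K y) = space S"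
  by (rule sets_eq_imp_space_eq) simp

lemma prob_K: "y \<in> space S \<Longrightarrow> prob_space (K y)"
  using measurable_space[OF kernel] by (simp add: space_prob_algebra)

lemma C_subset: "C \<subseteq> space S"
  by (simp add: C_sets sets.sets_into_space)

text \<open>The constant \<open>b / \<delta>\<close> ensures \<open>\<delta> \<eta>(U) \<ge> b\<close>, so that the subtracted part of \<open>Q\<close> absorbs
  the term \<open>b 1_C\<close> of the drift condition.\<close>

definition U :: "'a \<Rightarrow> real" where "U y = W y + b / \<delta>"

text \<open>The supremum of (l w + a) / (w + a) over w \<ge> 1, with a =
  \<open>b / \<delta>\<close>: the quotient does not increase in w, so its value at w = 1 is the
  largest.\<close>

definition \<rho> :: real where "\<rho> = (l + b / \<delta>) / (1 + b / \<delta>)"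

text \<open>A ball in the supremum norm weighted by \<open>U\<close>, with an explicit radius
  because the final bounds must be the same for all kernels of the family.\<close>

definition dominated :: "real \<Rightarrow> ('a \<Rightarrow> real) \<Rightarrow> bool" where
  "dominated c u \<longleftrightarrow> u \<in> borel_measurable S \<and> (\<forall>y\<in>space S. \<bar>u y\<bar> \<le> c * U y)"

lemma U_measurable [measurable]: "U \<in> borel_measurable S"
  unfolding U_def by measurable

lemma U_ge_1: "y \<in> space S \<Longrightarrow> 1 \<le> U y"
  using W_ge_1[of y] b \<delta> by (simp add: U_def add_increasing2)

lemma \<rho>_bounds: "0 \<le> \<rho>" "\<rho> < 1"
  using l b \<delta> by (auto simp: \<rho>_def field_simps add_pos_nonneg)

lemma dominated_measurable [measurable_dest]: "dominated c u \<Longrightarrow> u \<in> borel_measurable S"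
  by (simp add: dominated_def)

lemma dominatedD: "dominated c u \<Longrightarrow> y \<in> space S \<Longrightarrow> \<bar>u y\<bar> \<le> c * U y"
  by (simp add: dominated_def)

lemma dominated_nonneg: "dominated c u \<Longrightarrow> y \<in> space S \<Longrightarrow> 0 \<le> c"
  using dominatedD[of c u y] U_ge_1[of y] by (smt (verit) mult_neg_pos)

lemma dominated_mono: "dominated c u \<Longrightarrow> c \<le> d \<Longrightarrow> dominated d u"
  unfolding dominated_def using U_ge_1
  by (meson mult_right_mono order_trans zero_le_one)

lemma dominated_U: "dominated 1 U"
  using U_ge_1 by (fastforce simp: dominated_def)

lemma dominated_add: "dominated c u \<Longrightarrow> dominated d v \<Longrightarrow> dominated (c + d) (\<lambda>y. u y + v y)"
  by (auto simp: dominated_def distrib_right intro!: order_trans[OF abs_triangle_ineq] add_mono)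

lemma dominated_cmult: "dominated c u \<Longrightarrow> dominated (\<bar>a\<bar> * c) (\<lambda>y. a * u y)"
  by (auto simp: dominated_def abs_mult mult.assoc intro!: mult_left_mono)

lemma dominated_diff: "dominated c u \<Longrightarrow> dominated d v \<Longrightarrow> dominated (c + d) (\<lambda>y. u y - v y)"
  using dominated_add[of c u d "\<lambda>y. -1 * v y"] dominated_cmult[of d v "-1"] by simp

lemma dominated_sum: "(\<And>i. i \<in> I \<Longrightarrow> dominated (c i) (u i)) \<Longrightarrow> dominated (\<Sum>i\<in>I. c i) (\<lambda>y. \<Sum>i\<in>I. u i y)"
  by (auto simp: dominated_def sum_distrib_right intro!: order_trans[OF sum_abs] sum_mono borel_measurable_sum)

lemma measurable_K: "y \<in> space S \<Longrightarrow> u \<in> borel_measurable S \<Longrightarrow> u \<in> borel_measurable (K y)"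
  by (simp cong: measurable_cong_sets)

lemma W_nonneg: "y \<in> space S \<Longrightarrow> 0 \<le> W y"
  using W_ge_1[of y] by simp

lemma integrable_W:
  assumes y: "y \<in> space S" shows "integrable (K y) W"
proof (rule integrableI_nonneg)
  show "W \<in> borel_measurable (K y)" using y by (rule measurable_K) simp
  show "AE x in K y. 0 \<le> W x" using y W_nonneg by (intro AE_I2) simp
  show "(\<integral>\<^sup>+ x. ennreal (W x) \<partial>K y) < \<infinity>"
    using drift[OF y] by (rule order.strict_trans1) simp
qed

lemma integrable_K:
  assumes "dominated c u" "y \<in> space S" shows "integrable (K y) u"
proof -
  interpret K: prob_space "K y" using assms prob_K by simp
  have "integrable (K y) (\<lambda>y'. c * U y')"
    using integrable_W[OF assms(2)] by (auto simp: U_def)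
  then show ?thesis
    by (rule Bochner_Integration.integrable_bound)
       (use assms in \<open>auto simp: dominated_def intro!: measurable_K order_trans[OF _ abs_ge_self]\<close>)
qed

lemma kernel_op_W_le: "y \<in> space S \<Longrightarrow> kernel_op K W y \<le> l * W y + b * indicator C y"
proof -
  assume y: "y \<in> space S"
  have "ennreal (kernel_op K W y) \<le> ennreal (l * W y + b * indicator C y)"
    unfolding kernel_op_def using integrable_W[OF y] drift[OF y] y W_nonneg
    by (subst nn_integral_eq_integral[symmetric]) (auto intro!: AE_I2)
  moreover have "0 \<le> l * W y + b * indicator C y"
    using l b W_nonneg[OF y] by simp
  ultimately show ?thesis by simp
qed

lemma kernel_op_add:
  "dominated c u \<Longrightarrow> dominated d v \<Longrightarrow> y \<in> space S \<Longrightarrow>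
    kernel_op K (\<lambda>y. u y + v y) y = kernel_op K u y + kernel_op K v y"
  by (simp add: kernel_op_def integrable_K)

lemma kernel_op_diff:
  "dominated c u \<Longrightarrow> dominated d v \<Longrightarrow> y \<in> space S \<Longrightarrow>
    kernel_op K (\<lambda>y. u y - v y) y = kernel_op K u y - kernel_op K v y"
  by (simp add: kernel_op_def integrable_K)

lemma kernel_op_sum:
  "(\<And>i. i \<in> I \<Longrightarrow> dominated (c i) (u i)) \<Longrightarrow> y \<in> space S \<Longrightarrow>
    kernel_op K (\<lambda>y. \<Sum>i\<in>I. u i y) y = (\<Sum>i\<in>I. kernel_op K (u i) y)"
  unfolding kernel_op_def by (rule Bochner_Integration.integral_sum) (rule integrable_K)

lemma kernel_op_cmult: "kernel_op K (\<lambda>y. a * u y) y = a * kernel_op K u y"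
  by (simp add: kernel_op_def)

lemma kernel_op_cong: "(\<And>y. y \<in> space S \<Longrightarrow> u y = v y) \<Longrightarrow> y \<in> space S \<Longrightarrow> kernel_op K u y = kernel_op K v y"
  unfolding kernel_op_def by (rule Bochner_Integration.integral_cong) auto

lemma kernel_op_mono:
  "dominated c u \<Longrightarrow> dominated d v \<Longrightarrow> (\<And>y. y \<in> space S \<Longrightarrow> u y \<le> v y) \<Longrightarrow> y \<in> space S \<Longrightarrow>
    kernel_op K u y \<le> kernel_op K v y"
  unfolding kernel_op_def by (rule integral_mono) (auto intro: integrable_K)

lemma kernel_op_measurable [measurable]: "u \<in> borel_measurable S \<Longrightarrow> kernel_op K u \<in> borel_measurable S"
  unfolding kernel_op_def
  by (rule integral_measurable_subprob_algebra2[where N=S]) (use kernel in \<open>auto simp: measurable_prob_algebraD\<close>)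

lemma kernel_op_U: "y \<in> space S \<Longrightarrow> kernel_op K U y = kernel_op K W y + b / \<delta>"
proof -
  assume y: "y \<in> space S"
  interpret K: prob_space "K y" using y prob_K by simp
  show ?thesis
    unfolding kernel_op_def U_def using integrable_W[OF y] by (simp add: K.prob_space)
qed

section \<open>The residual kernel and its contraction\<close>

text \<open>The residual kernel of Nummelin's splitting. Minorization makes it positive, so its
  weighted norm is decided by its value at \<open>U\<close> alone.\<close>

definition Q :: "('a \<Rightarrow> real) \<Rightarrow> 'a \<Rightarrow> real" where
  "Q u y = kernel_op K u y - \<delta> * indicator C y * (\<integral>z. u z \<partial>\<eta>)"

lemma nn_integral_\<eta>_le:
  "y \<in> C \<Longrightarrow> u \<in> borel_measurable S \<Longrightarrow> ennreal \<delta> * (\<integral>\<^sup>+z. u z \<partial>\<eta>) \<le> (\<integral>\<^sup>+z. u z \<partial>K y)"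
  using C_subset by (intro nn_integral_ge_of_minorization minorization) (auto simp: sets_\<eta> cong: measurable_cong_sets)

text \<open>\<open>\<eta>\<close> is controlled only through the kernel at a point of
  \<open>C\<close>, hence the point in the assumptions. If \<open>C\<close> is empty, nothing is
  known about moments of \<open>\<eta>\<close>, but then the factor \<open>indicator C y\<close> in
  \<open>Q\<close> removes the integral.\<close>

lemma integrable_\<eta>:
  assumes "dominated c u" "y \<in> C" shows "integrable \<eta> u"
proof -
  have y: "y \<in> space S" using assms C_subset by auto
  have "ennreal \<delta> * (\<integral>\<^sup>+z. ennreal (norm (u z)) \<partial>\<eta>) \<le> (\<integral>\<^sup>+z. ennreal (norm (u z)) \<partial>K y)"
    using assms by (intro nn_integral_\<eta>_le) auto
  also have "\<dots> < \<infinity>"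
    using integrable_K[OF assms(1) y] by (simp add: integrable_iff_bounded)
  finally have "(\<integral>\<^sup>+z. ennreal (norm (u z)) \<partial>\<eta>) < \<infinity>"
    using \<delta> by (auto simp: ennreal_mult_less_top)
  then show ?thesis using assms by (auto simp: integrable_iff_bounded)
qed

lemma integral_\<eta>_le:
  assumes "dominated c u" "y \<in> C" "\<And>z. z \<in> space S \<Longrightarrow> 0 \<le> u z"
  shows "\<delta> * (\<integral>z. u z \<partial>\<eta>) \<le> kernel_op K u y"
proof -
  have y: "y \<in> space S" using assms C_subset by auto
  have [simp]: "space \<eta> = space S" by (rule sets_eq_imp_space_eq[OF sets_\<eta>])
  have "ennreal (\<delta> * (\<integral>z. u z \<partial>\<eta>)) = ennreal \<delta> * (\<integral>\<^sup>+z. u z \<partial>\<eta>)"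
    using \<delta> assms by (subst nn_integral_eq_integral) (auto simp: ennreal_mult' intro!: integrable_\<eta> AE_I2)
  also have "\<dots> \<le> (\<integral>\<^sup>+z. u z \<partial>K y)"
    using assms by (intro nn_integral_\<eta>_le) auto
  also have "\<dots> = ennreal (kernel_op K u y)"
    unfolding kernel_op_def using assms y by (intro nn_integral_eq_integral) (auto intro!: integrable_K AE_I2)
  finally show ?thesis
    using assms y by (subst (asm) ennreal_le_iff) (auto simp: kernel_op_def intro!: Bochner_Integration.integral_nonneg_AE)
qed

lemma Q_measurable [measurable]: "u \<in> borel_measurable S \<Longrightarrow> Q u \<in> borel_measurable S"
  unfolding Q_def by (intro borel_measurable_diff borel_measurable_times kernel_op_measurable) simp_all

lemma Q_U_le: "y \<in> space S \<Longrightarrow> Q U y \<le> \<rho> * U y"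
proof -
  assume y: "y \<in> space S"
  let ?a = "b / \<delta>"
  have a: "0 \<le> ?a" using b \<delta> by simp
  have "Q U y \<le> l * W y + ?a"
  proof (cases "y \<in> C")
    case True
    interpret \<eta>: prob_space \<eta> by (rule prob_\<eta>)
    have [simp]: "space \<eta> = space S" by (rule sets_eq_imp_space_eq[OF sets_\<eta>])
    have "(\<integral>z. U z \<partial>\<eta>) \<ge> (\<integral>z. 1 + ?a \<partial>\<eta>)"
      using W_ge_1 by (intro integral_mono integrable_\<eta>[OF dominated_U True]) (auto simp: U_def)
    then have "\<delta> * (\<integral>z. U z \<partial>\<eta>) \<ge> \<delta> * ?a"
      using \<delta> \<eta>.prob_space by (intro mult_left_mono) auto
    then have "\<delta> * (\<integral>z. U z \<partial>\<eta>) \<ge> b" using \<delta> by simp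
    then show ?thesis
      using kernel_op_W_le[OF y] True by (simp add: Q_def kernel_op_U[OF y])
  next
    case False
    then show ?thesis using kernel_op_W_le[OF y] by (simp add: Q_def kernel_op_U[OF y])
  qed
  also have "\<dots> \<le> \<rho> * (W y + ?a)"
  proof -
    \<comment> \<open>Both sides are affine in \<open>W y\<close> and agree at
      \<open>W y = 1\<close> by the choice of \<open>\<rho>\<close>; \<open>W_ge_1\<close> puts the
      argument on the favourable side of that point.\<close>
    have "(l * W y + ?a) * (1 + ?a) \<le> (l + ?a) * (W y + ?a)"
    proof -
      have "(l + ?a) * (W y + ?a) - (l * W y + ?a) * (1 + ?a) = ?a * (1 - l) * (W y - 1)"
        by algebra
      also have "\<dots> \<ge> 0" using a l W_ge_1[OF y] by (intro mult_nonneg_nonneg) auto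
      finally show ?thesis by simp
    qed
    then show ?thesis using a by (simp add: \<rho>_def pos_le_divide_eq)
  qed
  finally show ?thesis by (simp add: U_def)
qed

lemma Q_diff:
  assumes "dominated c u" "dominated d v" "y \<in> space S"
  shows "Q (\<lambda>y. u y - v y) y = Q u y - Q v y"
  using assms by (cases "y \<in> C") (auto simp: Q_def kernel_op_diff integrable_\<eta>[of _ _ y] algebra_simps)

lemma Q_add:
  assumes "dominated c u" "dominated d v" "y \<in> space S"
  shows "Q (\<lambda>y. u y + v y) y = Q u y + Q v y"
  using assms by (cases "y \<in> C") (auto simp: Q_def kernel_op_add integrable_\<eta>[of _ _ y] algebra_simps)

lemma Q_cmult: "Q (\<lambda>y. a * u y) y = a * Q u y"
  by (simp add: Q_def kernel_op_cmult algebra_simps)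

lemma Q_nonneg:
  assumes "dominated c u" "y \<in> space S" "\<And>z. z \<in> space S \<Longrightarrow> 0 \<le> u z"
  shows "0 \<le> Q u y"
proof (cases "y \<in> C")
  case True
  then show ?thesis using integral_\<eta>_le[OF assms(1) True assms(3)] by (simp add: Q_def)
next
  case False
  then show ?thesis
    using assms by (auto simp: Q_def kernel_op_def intro!: Bochner_Integration.integral_nonneg_AE AE_I2)
qed

text \<open>Positivity of \<open>Q\<close>, applied to c U - u and c U + u, squeezes Q u between - c
  Q U and c Q U.\<close>

lemma dominated_Q:
  assumes u: "dominated c u" shows "dominated (c * \<rho>) (Q u)"
  unfolding dominated_def
proof (intro conjI ballI)
  show "Q u \<in> borel_measurable S" using u by measurable
  fix y assume y: "y \<in> space S"
  have cU: "dominated (\<bar>c\<bar> * 1) (\<lambda>y. c * U y)" by (rule dominated_cmult[OF dominated_U])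
  have "0 \<le> Q (\<lambda>y. c * U y - u y) y"
    using dominatedD[OF u] by (intro Q_nonneg[OF dominated_diff[OF cU u] y]) fastforce
  moreover have "0 \<le> Q (\<lambda>y. c * U y + u y) y"
    using dominatedD[OF u] by (intro Q_nonneg[OF dominated_add[OF cU u] y]) fastforce
  ultimately have "\<bar>Q u y\<bar> \<le> c * Q U y"
    using y by (simp add: Q_add[OF cU u] Q_diff[OF cU u] Q_cmult)
  also have "\<dots> \<le> c * (\<rho> * U y)"
    using dominated_nonneg[OF u y] Q_U_le[OF y] by (intro mult_left_mono)
  finally show "\<bar>Q u y\<bar> \<le> c * \<rho> * U y" by (simp add: mult.assoc)
qed

lemma dominated_Q_pow: "dominated c u \<Longrightarrow> dominated (c * \<rho> ^ n) ((Q ^^ n) u)"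
proof (induction n)
  case (Suc n)
  then show ?case using dominated_Q[of "c * \<rho> ^ n" "(Q ^^ n) u"] by (simp add: ac_simps)
qed simp

section \<open>Powers of the kernel\<close>

abbreviation P_pow :: "nat \<Rightarrow> ('a \<Rightarrow> real) \<Rightarrow> 'a \<Rightarrow> real" where
  "P_pow k \<equiv> kernel_op K ^^ k"

text \<open>The fixed point of t -> l t + b, hence the level to which repeated use of the drift
  pulls the mean of \<open>W\<close>.\<close>

definition B :: real where "B = b / (1 - l)"

lemma B_nonneg: "0 \<le> B"
  using b l by (simp add: B_def)

text \<open>The right side is a convex combination of \<open>U y\<close> and the constant
  \<open>b / \<delta> + B\<close>. Iterating a bound of this form only replaces l by l^k.\<close>

lemma kernel_op_U_le:
  assumes y: "y \<in> space S"
  shows "kernel_op K U y \<le> l * U y + (1 - l) * (b / \<delta> + B)"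
proof -
  have "kernel_op K U y \<le> l * W y + b + b / \<delta>"
    using kernel_op_W_le[OF y] b by (cases "y \<in> C") (auto simp: kernel_op_U[OF y])
  also have "\<dots> = l * U y + (1 - l) * (b / \<delta>) + (1 - l) * B"
  proof -
    have "(1 - l) * B = b" using l by (simp add: B_def)
    moreover have "l * (b / \<delta>) + (1 - l) * (b / \<delta>) = b / \<delta>" by (simp add: algebra_simps add_divide_distrib[symmetric])
    ultimately show ?thesis by (simp add: U_def distrib_left)
  qed
  finally show ?thesis by (simp add: algebra_simps)
qed

lemma P_pow_bound:
  assumes u: "dominated c u" and y: "y \<in> space S"
  shows "P_pow k u \<in> borel_measurable S" "\<bar>P_pow k u y\<bar> \<le> c * (l ^ k * U y + (1 - l ^ k) * (b / \<delta> + B))"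
  using y
proof (induction k arbitrary: y)
  case 0
  show "P_pow 0 u \<in> borel_measurable S" using u by simp
  show "\<bar>P_pow 0 u y\<bar> \<le> c * (l ^ 0 * U y + (1 - l ^ 0) * (b / \<delta> + B))" if "y \<in> space S" for y
    using dominatedD[OF u that] by simp
next
  case (Suc k)
  let ?v = "\<lambda>z. c * (l ^ k * U z + (1 - l ^ k) * (b / \<delta> + B))"
  have c: "0 \<le> c" using dominated_nonneg[OF u assms(2)] .
  have lk: "0 \<le> l ^ k" "l ^ k \<le> 1" using l by (auto intro: power_le_one)
  have bB: "0 \<le> b / \<delta> + B" using B_nonneg b \<delta> by simp
  show "P_pow (Suc k) u \<in> borel_measurable S" using Suc(1)[OF assms(2)] by simp
  \<comment> \<open>The facts \<open>v\<close> and \<open>d\<close> make the integrals in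
    \<open>kernel_op_mono\<close> legitimate; their crude constant does not enter the bound being
    proved.\<close>
  have v: "dominated (c * (l ^ k + (1 - l ^ k) * (b / \<delta> + B))) ?v"
    unfolding dominated_def
  proof (intro conjI ballI)
    fix z assume z: "z \<in> space S"
    have "(1 - l ^ k) * (b / \<delta> + B) * 1 \<le> (1 - l ^ k) * (b / \<delta> + B) * U z"
      using U_ge_1[OF z] lk bB by (intro mult_left_mono) auto
    moreover have "0 \<le> ?v z"
      using c lk bB U_ge_1[OF z] mult_nonneg_nonneg[of "l ^ k" "U z"]
        mult_nonneg_nonneg[of "1 - l ^ k" "b / \<delta> + B"] by (intro mult_nonneg_nonneg) auto
    ultimately show "\<bar>?v z\<bar> \<le> c * (l ^ k + (1 - l ^ k) * (b / \<delta> + B)) * U z"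
      using c by (auto simp: mult.assoc distrib_right intro!: mult_left_mono)
  qed simp
  have d: "dominated (c * (l ^ k + (1 - l ^ k) * (b / \<delta> + B))) (P_pow k u)"
    unfolding dominated_def
  proof (intro conjI ballI)
    show "P_pow k u \<in> borel_measurable S" using Suc(1)[OF assms(2)] .
    fix z assume z: "z \<in> space S"
    show "\<bar>P_pow k u z\<bar> \<le> c * (l ^ k + (1 - l ^ k) * (b / \<delta> + B)) * U z"
      using Suc(2)[OF z] dominatedD[OF v z] by linarith
  qed
  show "\<bar>P_pow (Suc k) u y\<bar> \<le> c * (l ^ Suc k * U y + (1 - l ^ Suc k) * (b / \<delta> + B))" if y: "y \<in> space S" for y
  proof -
    interpret K: prob_space "K y" by (rule prob_K[OF y])
    have vy: "kernel_op K ?v y = c * (l ^ k * kernel_op K U y + (1 - l ^ k) * (b / \<delta> + B))"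
      unfolding kernel_op_def
      using integrable_K[OF dominated_U y] K.prob_space
      by (subst Bochner_Integration.integral_mult_right_zero, subst Bochner_Integration.integral_add) auto
    have "kernel_op K (P_pow k u) y \<le> kernel_op K ?v y"
      using Suc(2) by (intro kernel_op_mono[OF d v _ y]) fastforce
    moreover have "kernel_op K (\<lambda>z. - 1 * ?v z) y \<le> kernel_op K (P_pow k u) y"
      using Suc(2) by (intro kernel_op_mono[OF dominated_cmult[OF v] d _ y]) fastforce
    ultimately have "\<bar>P_pow (Suc k) u y\<bar> \<le> kernel_op K ?v y"
      unfolding kernel_op_cmult by simp
    also have "\<dots> \<le> c * (l ^ k * (l * U y + (1 - l) * (b / \<delta> + B)) + (1 - l ^ k) * (b / \<delta> + B))"
      unfolding vy using kernel_op_U_le[OF y] c lk by (intro mult_left_mono add_right_mono) auto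
    also have "\<dots> = c * (l ^ Suc k * U y + (1 - l ^ Suc k) * (b / \<delta> + B))"
      unfolding power_Suc by algebra
    finally show ?thesis .
  qed
qed

text \<open>An upper bound, uniform in k, for the \<open>U\<close>-weighted norm of the k-th power
  of the kernel.\<close>

definition L :: real where "L = 1 + b / \<delta> + B"

lemma L_ge_1: "1 \<le> L"
  using B_nonneg b \<delta> by (simp add: L_def)

lemma dominated_P_pow:
  assumes u: "dominated c u" shows "dominated (c * L) (P_pow k u)"
proof (cases "space S = {}")
  \<comment> \<open>On an empty space \<open>P_pow_bound\<close>, which assumes a point even for its
    measurability half, cannot be applied.\<close>
  case True
  then show ?thesis
    by (auto simp: dominated_def measurable_def space_empty_iff)
next
  case False
  then obtain y0 where y0: "y0 \<in> space S" by auto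
  have lk: "0 \<le> l ^ k" "l ^ k \<le> 1" using l by (auto intro: power_le_one)
  have bB: "0 \<le> b / \<delta> + B" using B_nonneg b \<delta> by simp
  show ?thesis
    unfolding dominated_def
  proof (intro conjI ballI)
    show "P_pow k u \<in> borel_measurable S" by (rule P_pow_bound(1)[OF u y0])
    fix y assume y: "y \<in> space S"
    have "l ^ k * U y + (1 - l ^ k) * (b / \<delta> + B) \<le> 1 * U y + 1 * (b / \<delta> + B)"
      using lk bB U_ge_1[OF y] by (intro add_mono mult_right_mono) auto
    also have "\<dots> \<le> U y + (b / \<delta> + B) * U y"
      using bB U_ge_1[OF y] mult_left_mono[of 1 "U y" "b / \<delta> + B"] by simp
    finally have "l ^ k * U y + (1 - l ^ k) * (b / \<delta> + B) \<le> L * U y"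
      by (simp add: L_def algebra_simps)
    then show "\<bar>P_pow k u y\<bar> \<le> c * L * U y"
      using P_pow_bound(2)[OF u y, of k] dominated_nonneg[OF u y]
      by (auto simp: mult.assoc intro: order_trans mult_left_mono)
  qed
qed

lemma P_pow_cong:
  "(\<And>y. y \<in> space S \<Longrightarrow> u y = v y) \<Longrightarrow> y \<in> space S \<Longrightarrow> P_pow k u y = P_pow k v y"
  by (induction k arbitrary: y) (auto intro: kernel_op_cong)

lemma P_pow_diff:
  assumes "dominated c u" "dominated d v"
  shows "y \<in> space S \<Longrightarrow> P_pow k (\<lambda>y. u y - v y) y = P_pow k u y - P_pow k v y"
proof (induction k arbitrary: y)
  case (Suc k)
  have "P_pow (Suc k) (\<lambda>y. u y - v y) y = kernel_op K (\<lambda>y. P_pow k u y - P_pow k v y) y"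
    using Suc by (auto intro: kernel_op_cong)
  then show ?case
    using Suc(2) by (simp add: kernel_op_diff[OF dominated_P_pow[OF assms(1)] dominated_P_pow[OF assms(2)]])
qed simp

lemma P_pow_add:
  assumes "dominated c u" "dominated d v"
  shows "y \<in> space S \<Longrightarrow> P_pow k (\<lambda>y. u y + v y) y = P_pow k u y + P_pow k v y"
proof (induction k arbitrary: y)
  case (Suc k)
  have "P_pow (Suc k) (\<lambda>y. u y + v y) y = kernel_op K (\<lambda>y. P_pow k u y + P_pow k v y) y"
    using Suc by (auto intro: kernel_op_cong)
  then show ?case
    using Suc(2) by (simp add: kernel_op_add[OF dominated_P_pow[OF assms(1)] dominated_P_pow[OF assms(2)]])
qed simp

lemma integral_\<eta>_sum:
  assumes "\<And>i. i \<in> I \<Longrightarrow> dominated (c i) (u i)" "y \<in> C"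
  shows "(\<integral>z. (\<Sum>i\<in>I. u i z) \<partial>\<eta>) = (\<Sum>i\<in>I. \<integral>z. u i z \<partial>\<eta>)"
  using assms by (intro Bochner_Integration.integral_sum integrable_\<eta>) auto

text \<open>For the finite Neumann sum g, telescoping gives g - Q g = u - Q^n u; writing Q in terms
  of P produces the \<open>\<eta>\<close> term. Staying with finite n avoids a limit of functions:
  later, n tends to infinity only in numerical inequalities.\<close>

lemma approximate_poisson:
  fixes u :: "'a \<Rightarrow> real" and n :: nat
  assumes u: "dominated c u" and y: "y \<in> space S"
  defines "g \<equiv> \<lambda>y. \<Sum>k<n. (Q ^^ k) u y"
  shows "u y = g y - kernel_op K g y + (Q ^^ n) u y + \<delta> * indicator C y * (\<integral>z. g z \<partial>\<eta>)"
proof -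
  have q: "dominated (c * \<rho> ^ k) ((Q ^^ k) u)" for k by (rule dominated_Q_pow[OF u])
  have "kernel_op K g y = (\<Sum>k<n. kernel_op K ((Q ^^ k) u) y)"
    unfolding g_def by (rule kernel_op_sum[OF q y])
  also have "\<dots> = (\<Sum>k<n. (Q ^^ Suc k) u y + \<delta> * indicator C y * (\<integral>z. (Q ^^ k) u z \<partial>\<eta>))"
    by (simp add: Q_def)
  also have "\<dots> = (\<Sum>k<n. (Q ^^ Suc k) u y) + \<delta> * indicator C y * (\<integral>z. g z \<partial>\<eta>)"
    using integral_\<eta>_sum[where I="{..<n}" and y=y, OF q]
    by (cases "y \<in> C") (simp_all add: g_def sum.distrib sum_distrib_left)
  also have "(\<Sum>k<n. (Q ^^ Suc k) u y) = g y + (Q ^^ n) u y - u y"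
    using sum.lessThan_Suc[of "\<lambda>k. (Q ^^ k) u y" n] sum.lessThan_Suc_shift[of "\<lambda>k. (Q ^^ k) u y" n]
    by (simp add: g_def)
  finally show ?thesis by simp
qed

end

section \<open>The invariant distribution and bounded partial sums\<close>

locale stationary_drift_minorization = drift_minorization +
  fixes \<mu> :: "'a measure"
  assumes invariant: "invariant_distribution S K \<mu>"
begin

lemma prob_\<mu>: "prob_space \<mu>" and sets_\<mu> [measurable_cong]: "sets \<mu> = sets S"
  using invariant by (auto simp: invariant_distribution_def)

lemma space_\<mu> [simp]: "space \<mu> = space S"
  by (rule sets_eq_imp_space_eq[OF sets_\<mu>])

sublocale \<mu>: prob_space \<mu> by (rule prob_\<mu>)

lemma nn_integral_invariant:
  assumes [measurable]: "u \<in> borel_measurable S"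
  shows "(\<integral>\<^sup>+y. (\<integral>\<^sup>+z. u z \<partial>K y) \<partial>\<mu>) = (\<integral>\<^sup>+y. u y \<partial>\<mu>)"
proof -
  have K: "K \<in> \<mu> \<rightarrow>\<^sub>M subprob_algebra S"
    using kernel sets_\<mu> by (auto simp: measurable_prob_algebraD cong: measurable_cong_sets)
  have ne: "space \<mu> \<noteq> {}" by (rule \<mu>.not_empty)
  have "\<mu> \<bind> K = \<mu>"
  proof (rule measure_eqI)
    have "sets (\<mu> \<bind> K) = sets S" by (rule sets_bind[OF _ ne]) simp
    then show s: "sets (\<mu> \<bind> K) = sets \<mu>" by (simp add: sets_\<mu>)
    fix A assume "A \<in> sets (\<mu> \<bind> K)"
    then have "A \<in> sets S" using s sets_\<mu> by simp
    then show "emeasure (\<mu> \<bind> K) A = emeasure \<mu> A"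
      using invariant by (simp add: emeasure_bind[OF ne K] invariant_distribution_def)
  qed
  then show ?thesis
    using nn_integral_bind[OF assms K] by simp
qed

text \<open>The integral of \<open>W\<close> may be infinite at this stage, so the integrated drift
  inequality cannot simply be rearranged. Invariance is applied to min W n instead, whose image
  under the kernel is at most min (l W + b) n, and Fatou's lemma handles the limit.\<close>

lemma nn_integral_W_le: "(\<integral>\<^sup>+y. ennreal (W y) \<partial>\<mu>) \<le> ennreal B"
proof -
  \<comment> \<open>The summand \<open>b\<close> keeps \<phi> nonnegative, as Fatou's lemma
    requires; the pointwise limit is (1 - l) W.\<close>
  define \<phi> where "\<phi> n y = min (W y) (real n) + b - min (l * W y + b) (real n)" for n y
  have [measurable]: "\<phi> n \<in> borel_measurable S" for n unfolding \<phi>_def by measurable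
  have \<phi>_nonneg: "0 \<le> \<phi> n y" if "y \<in> space S" for n y
    using b l mult_right_mono[of l 1 "W y"] W_nonneg[OF that] by (auto simp: \<phi>_def min_def)
  have \<phi>_le: "(\<integral>\<^sup>+y. ennreal (\<phi> n y) \<partial>\<mu>) \<le> ennreal b" for n
  proof -
    have i1: "integrable \<mu> (\<lambda>y. min (W y) (real n))"
      using W_nonneg by (intro \<mu>.integrable_const_bound[where B="real n"] AE_I2) auto
    have i2: "integrable \<mu> (\<lambda>y. min (l * W y + b) (real n))"
      using W_nonneg l b by (intro \<mu>.integrable_const_bound[where B="real n"] AE_I2) auto
    have "(\<integral>\<^sup>+y. ennreal (min (W y) (real n)) \<partial>\<mu>) = (\<integral>\<^sup>+y. (\<integral>\<^sup>+z. ennreal (min (W z) (real n)) \<partial>K y) \<partial>\<mu>)"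
      by (subst nn_integral_invariant) auto
    also have "\<dots> \<le> (\<integral>\<^sup>+y. ennreal (min (l * W y + b) (real n)) \<partial>\<mu>)"
    proof (intro nn_integral_mono)
      fix y assume "y \<in> space \<mu>"
      then have y: "y \<in> space S" by simp
      interpret K: prob_space "K y" by (rule prob_K[OF y])
      have "(\<integral>\<^sup>+z. ennreal (min (W z) (real n)) \<partial>K y) \<le> (\<integral>\<^sup>+z. ennreal (W z) \<partial>K y)"
        by (intro nn_integral_mono ennreal_leI) auto
      also have "\<dots> \<le> ennreal (l * W y + b)"
        using drift[OF y] b by (auto elim!: order_trans intro!: ennreal_leI simp: indicator_def)
      finally have 1: "(\<integral>\<^sup>+z. ennreal (min (W z) (real n)) \<partial>K y) \<le> ennreal (l * W y + b)" .
      have "(\<integral>\<^sup>+z. ennreal (min (W z) (real n)) \<partial>K y) \<le> (\<integral>\<^sup>+z. ennreal (real n) \<partial>K y)"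
        by (intro nn_integral_mono ennreal_leI) auto
      then have "(\<integral>\<^sup>+z. ennreal (min (W z) (real n)) \<partial>K y) \<le> ennreal (real n)"
        by (simp add: K.emeasure_space_1)
      with 1 show "(\<integral>\<^sup>+z. ennreal (min (W z) (real n)) \<partial>K y) \<le> ennreal (min (l * W y + b) (real n))"
        by (auto simp: min_def)
    qed
    finally have "(\<integral>y. min (W y) (real n) \<partial>\<mu>) \<le> (\<integral>y. min (l * W y + b) (real n) \<partial>\<mu>)"
      using W_nonneg l b
      by (subst (asm) (1 2) nn_integral_eq_integral, (auto simp: i1 i2 intro!: AE_I2)[4], subst (asm) ennreal_le_iff)
         (auto intro!: integral_nonneg_AE AE_I2)
    then have "(\<integral>y. \<phi> n y \<partial>\<mu>) \<le> b"
      unfolding \<phi>_def using i1 i2 by (simp add: \<mu>.prob_space[simplified])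
    moreover have "integrable \<mu> (\<phi> n)"
      unfolding \<phi>_def using i1 i2 by auto
    ultimately show ?thesis
      using \<phi>_nonneg by (subst nn_integral_eq_integral) (auto intro!: ennreal_leI)
  qed
  have lim: "(\<lambda>n. ennreal (\<phi> n y)) \<longlonglongrightarrow> ennreal ((1 - l) * W y)" if "y \<in> space S" for y
  proof (intro tendsto_ennrealI tendsto_eventually)
    have "\<forall>\<^sub>F n in sequentially. l * W y + b \<le> real n \<and> W y \<le> real n"
      by (intro eventually_conj) (auto intro: eventually_sequentiallyI[of "nat \<lceil>_\<rceil>"] simp: nat_le_iff ceiling_le_iff)
    then show "\<forall>\<^sub>F n in sequentially. \<phi> n y = (1 - l) * W y"
      by eventually_elim (auto simp: \<phi>_def min_def algebra_simps)
  qed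
  have "ennreal (1 - l) * (\<integral>\<^sup>+y. ennreal (W y) \<partial>\<mu>) = (\<integral>\<^sup>+y. liminf (\<lambda>n. ennreal (\<phi> n y)) \<partial>\<mu>)"
    using l W_nonneg lim_imp_Liminf[OF _ lim]
    by (subst nn_integral_cmult[symmetric]) (auto simp: ennreal_mult intro!: nn_integral_cong)
  also have "\<dots> \<le> liminf (\<lambda>n. \<integral>\<^sup>+y. ennreal (\<phi> n y) \<partial>\<mu>)"
    by (intro nn_integral_liminf) simp
  also have "\<dots> \<le> ennreal b"
    using \<phi>_le by (intro Liminf_le) auto
  also have "\<dots> = ennreal (1 - l) * ennreal B"
    using l b by (simp add: B_def ennreal_mult[symmetric])
  finally show ?thesis
    using l by (subst (asm) ennreal_mult_le_mult_iff) auto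
qed

lemma integrable_\<mu>: 
  assumes u: "dominated c u" shows "integrable \<mu> u"
proof -
  have "integrable \<mu> W"
  proof (rule integrableI_nonneg)
    show "(\<integral>\<^sup>+y. ennreal (W y) \<partial>\<mu>) < \<infinity>"
      using nn_integral_W_le by (rule order.strict_trans1) simp
  qed (use W_nonneg in auto)
  then have "integrable \<mu> (\<lambda>y. c * U y)" by (simp add: U_def)
  then show ?thesis
    by (rule Bochner_Integration.integrable_bound)
      (use u in \<open>auto simp: dominated_def intro!: order_trans[OF _ abs_ge_self]\<close>)
qed

lemma integral_kernel_op:
  assumes u: "dominated c u" shows "(\<integral>y. kernel_op K u y \<partial>\<mu>) = (\<integral>y. u y \<partial>\<mu>)"
proof -
  have nonneg: "(\<integral>y. kernel_op K v y \<partial>\<mu>) = (\<integral>y. v y \<partial>\<mu>)"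
    if v: "dominated d v" and "\<And>y. y \<in> space S \<Longrightarrow> 0 \<le> v y" for d v
  proof -
    have "(\<integral>y. kernel_op K v y \<partial>\<mu>) = enn2real (\<integral>\<^sup>+y. ennreal (kernel_op K v y) \<partial>\<mu>)"
    proof (rule integral_eq_nn_integral)
      show "kernel_op K v \<in> borel_measurable \<mu>"
        using kernel_op_measurable[OF dominated_measurable[OF v]] by (simp add: sets_\<mu> cong: measurable_cong_sets)
      show "AE y in \<mu>. 0 \<le> kernel_op K v y"
        using that by (intro AE_I2) (auto simp: kernel_op_def intro!: integral_nonneg_AE)
    qed
    also have "(\<integral>\<^sup>+y. ennreal (kernel_op K v y) \<partial>\<mu>) = (\<integral>\<^sup>+y. (\<integral>\<^sup>+z. ennreal (v z) \<partial>K y) \<partial>\<mu>)"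
      using that by (intro nn_integral_cong) (auto simp: kernel_op_def intro!: nn_integral_eq_integral[symmetric] integrable_K)
    also have "enn2real \<dots> = (\<integral>y. v y \<partial>\<mu>)"
      using v that by (subst nn_integral_invariant) (auto intro!: integral_eq_nn_integral[symmetric])
    finally show ?thesis .
  qed
  \<comment> \<open>Adding c U makes u nonnegative, so the nonnegative case applies to u + c U and
    to c U, and the difference gives u.\<close>
  let ?U = "\<lambda>y. c * U y"
  have cU: "dominated (\<bar>c\<bar> * 1) ?U" by (rule dominated_cmult[OF dominated_U])
  have c: "0 \<le> c" using \<mu>.not_empty dominated_nonneg[OF u] by auto
  have P: "dominated (d * L) (kernel_op K v)" if "dominated d v" for d v
    using dominated_P_pow[OF that, of 1] by simp
  have "(\<integral>y. kernel_op K u y \<partial>\<mu>) + (\<integral>y. kernel_op K ?U y \<partial>\<mu>) = (\<integral>y. kernel_op K (\<lambda>y. u y + ?U y) y \<partial>\<mu>)"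
    by (subst Bochner_Integration.integral_add[symmetric])
       (auto intro!: Bochner_Integration.integral_cong integrable_\<mu>[OF P] u cU simp: kernel_op_add[OF u cU])
  also have "\<dots> = (\<integral>y. u y + ?U y \<partial>\<mu>)"
    using dominatedD[OF u] by (intro nonneg[OF dominated_add[OF u cU]]) fastforce
  also have "\<dots> = (\<integral>y. u y \<partial>\<mu>) + (\<integral>y. ?U y \<partial>\<mu>)"
    by (intro Bochner_Integration.integral_add integrable_\<mu>[OF u] integrable_\<mu>[OF cU])
  also have "(\<integral>y. ?U y \<partial>\<mu>) = (\<integral>y. kernel_op K ?U y \<partial>\<mu>)"
    using c by (intro nonneg[OF cU, symmetric]) (auto dest: U_ge_1)
  finally show ?thesis by simp
qed

text \<open>Off \<open>C\<close> the operators P and Q agree. If \<open>C\<close> were a null set,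
  integrating Q U \<le> \<rho> U would give \<mu>(U) \<le> \<rho> \<mu>(U), although \<mu>(U) is
  finite and at least 1.\<close>

lemma measure_C_pos: "0 < measure \<mu> C"
proof (rule ccontr)
  assume "\<not> 0 < measure \<mu> C"
  then have "emeasure \<mu> C = 0"
    using measure_nonneg[of \<mu> C] by (simp add: \<mu>.emeasure_eq_measure)
  then have "AE y in \<mu>. y \<notin> C"
    by (intro AE_not_in) (auto simp: null_sets_def sets_\<mu>)
  moreover have "kernel_op K U y \<le> \<rho> * U y" if "y \<in> space S" "y \<notin> C" for y
    using Q_U_le[OF that(1)] that(2) by (simp add: Q_def)
  ultimately have "AE y in \<mu>. kernel_op K U y \<le> \<rho> * U y"
    using AE_space by (auto elim: eventually_elim2)
  moreover have P: "dominated (1 * L) (kernel_op K U)"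
    using dominated_P_pow[OF dominated_U, of 1] by simp
  ultimately have "(\<integral>y. kernel_op K U y \<partial>\<mu>) \<le> (\<integral>y. \<rho> * U y \<partial>\<mu>)"
    by (intro integral_mono_AE integrable_\<mu>[OF P]) (simp_all add: integrable_\<mu>[OF dominated_U])
  then have "(\<integral>y. U y \<partial>\<mu>) \<le> \<rho> * (\<integral>y. U y \<partial>\<mu>)"
    by (simp add: integral_kernel_op[OF dominated_U])
  moreover have "1 \<le> (\<integral>y. U y \<partial>\<mu>)"
    using U_ge_1 integral_mono[of \<mu> "\<lambda>_. 1" U] \<mu>.prob_space integrable_\<mu>[OF dominated_U] by simp
  ultimately show False
    using \<rho>_bounds mult_strict_right_mono[of \<rho> 1 "\<integral>y. U y \<partial>\<mu>"] by linarith
qed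

text \<open>For each n, u equals g_n - P g_n up to an error e_n of order \<rho>^n, so the sum of m
  terms is g_n - P^m g_n plus a total error of order m \<rho>^n. Letting n tend to infinity with m
  fixed leaves a bound free of m and of \<open>\<mu>\<close>.\<close>

theorem partial_sums_bound:
  assumes u: "dominated c u" and centred: "(\<integral>y. u y \<partial>\<mu>) = 0" and y: "y \<in> space S"
  shows "\<bar>\<Sum>k<m. P_pow k u y\<bar> \<le> c * ((1 + L) / (1 - \<rho>)) * U y"
proof -
  define g where "g n = (\<lambda>y. \<Sum>k<n. (Q ^^ k) u y)" for n
  define d where "d n = \<delta> * (\<integral>z. g n z \<partial>\<eta>)" for n
  define e where "e n = (\<lambda>y. (Q ^^ n) u y + d n * indicator C y)" for n
  \<comment> \<open>The only constant here that depends on \<open>\<mu>\<close>. It multiplies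
    \<rho>^n and disappears in the limit.\<close>
  define c' where "c' = c + c * (\<integral>y. U y \<partial>\<mu>) / measure \<mu> C"
  have c: "0 \<le> c" using dominated_nonneg[OF u y] .
  have q: "dominated (c * \<rho> ^ k) ((Q ^^ k) u)" for k by (rule dominated_Q_pow[OF u])
  have g_dom: "dominated (c / (1 - \<rho>)) (g n)" for n
  proof (rule dominated_mono)
    show "dominated (\<Sum>k<n. c * \<rho> ^ k) (g n)"
      unfolding g_def by (rule dominated_sum[OF q])
    have "(\<Sum>k<n. \<rho> ^ k) \<le> 1 / (1 - \<rho>)"
      using \<rho>_bounds by (simp add: sum_gp_strict divide_right_mono)
    then show "(\<Sum>k<n. c * \<rho> ^ k) \<le> c / (1 - \<rho>)"
      using c mult_left_mono by (fastforce simp: sum_distrib_left[symmetric])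
  qed
  have Pg_dom: "dominated (c / (1 - \<rho>) * L) (kernel_op K (g n))" for n
    using dominated_P_pow[OF g_dom, of 1] by simp
  have u_eq: "u z = g n z - kernel_op K (g n) z + e n z" if "z \<in> space S" for z n
    using approximate_poisson[OF u that, of n] by (simp add: g_def e_def d_def)
  have ind: "dominated 1 (indicator C)"
    using U_ge_1 by (fastforce simp: dominated_def indicator_def)
  have d_bound: "\<bar>d n\<bar> \<le> c * (\<integral>y. U y \<partial>\<mu>) / measure \<mu> C * \<rho> ^ n" for n
  proof -
    \<comment> \<open>Integrating the approximate equation against \<open>\<mu>\<close> cancels g
      and P g. Since u has mean 0, the coefficient \<open>d n\<close> is determined by Q^n u and
      inherits its geometric decay: the approximate form of \<eta>(g) = 0.\<close>
    have "(\<integral>z. u z \<partial>\<mu>) = (\<integral>z. g n z - kernel_op K (g n) z + ((Q ^^ n) u z + d n * indicator C z) \<partial>\<mu>)"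
      using u_eq[of _ n, unfolded e_def] by (intro Bochner_Integration.integral_cong) auto
    also have "\<dots> = (\<integral>z. g n z \<partial>\<mu>) - (\<integral>z. kernel_op K (g n) z \<partial>\<mu>) + ((\<integral>z. (Q ^^ n) u z \<partial>\<mu>) + d n * (\<integral>z. indicator C z \<partial>\<mu>))"
      using integrable_\<mu>[OF g_dom] integrable_\<mu>[OF Pg_dom] integrable_\<mu>[OF q] integrable_\<mu>[OF ind] by simp
    also have "\<dots> = (\<integral>z. (Q ^^ n) u z \<partial>\<mu>) + d n * measure \<mu> C"
      using C_subset by (simp add: integral_kernel_op[OF g_dom] Int_absorb2)
    finally have "d n * measure \<mu> C = - (\<integral>z. (Q ^^ n) u z \<partial>\<mu>)"
      using centred by simp
    then have "\<bar>d n\<bar> * measure \<mu> C = \<bar>\<integral>z. (Q ^^ n) u z \<partial>\<mu>\<bar>"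
      using measure_C_pos by (metis abs_minus_cancel abs_mult abs_of_pos)
    also have "\<dots> \<le> (\<integral>z. c * \<rho> ^ n * U z \<partial>\<mu>)"
      using dominatedD[OF q] integrable_\<mu>[OF dominated_U] integrable_\<mu>[OF q]
      by (intro order_trans[OF integral_abs_bound] integral_mono) auto
    finally show ?thesis
      using measure_C_pos by (simp add: field_simps)
  qed
  have e_dom: "dominated (c' * \<rho> ^ n) (e n)" for n
  proof (rule dominated_mono)
    show "dominated (c * \<rho> ^ n + \<bar>d n\<bar> * 1) (e n)"
      unfolding e_def by (intro dominated_add q dominated_cmult ind)
    show "c * \<rho> ^ n + \<bar>d n\<bar> * 1 \<le> c' * \<rho> ^ n"
      using d_bound[of n] by (simp add: c'_def distrib_right)
  qed
  have P_u: "P_pow k u y = P_pow k (g n) y - P_pow (Suc k) (g n) y + P_pow k (e n) y" for k n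
  proof -
    have "P_pow k u y = P_pow k (\<lambda>z. g n z - kernel_op K (g n) z + e n z) y"
      by (rule P_pow_cong[OF u_eq y])
    then show ?thesis
      using y by (simp add: P_pow_add[OF dominated_diff[OF g_dom Pg_dom] e_dom] P_pow_diff[OF g_dom Pg_dom]
          funpow_swap1)
  qed
  have bound: "\<bar>\<Sum>k<m. P_pow k u y\<bar> \<le> c * ((1 + L) / (1 - \<rho>)) * U y + real m * c' * L * U y * \<rho> ^ n" for n
  proof -
    have "(\<Sum>k<m. P_pow k u y) = (\<Sum>k<m. P_pow k (g n) y - P_pow (Suc k) (g n) y) + (\<Sum>k<m. P_pow k (e n) y)"
      unfolding P_u[of _ n] by (rule sum.distrib)
    also have "(\<Sum>k<m. P_pow k (g n) y - P_pow (Suc k) (g n) y) = g n y - P_pow m (g n) y"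
      by (subst sum_lessThan_telescope') simp
    finally have "\<bar>\<Sum>k<m. P_pow k u y\<bar> \<le> \<bar>g n y\<bar> + \<bar>P_pow m (g n) y\<bar> + (\<Sum>k<m. \<bar>P_pow k (e n) y\<bar>)"
      using sum_abs[of "\<lambda>k. P_pow k (e n) y" "{..<m}"] by linarith
    also have "\<dots> \<le> c / (1 - \<rho>) * U y + c / (1 - \<rho>) * L * U y + (\<Sum>k<m. c' * \<rho> ^ n * L * U y)"
      by (intro add_mono sum_mono dominatedD[OF g_dom y] dominatedD[OF dominated_P_pow[OF g_dom] y]
          dominatedD[OF dominated_P_pow[OF e_dom] y])
    also have "\<dots> = c * ((1 + L) / (1 - \<rho>)) * U y + real m * c' * L * U y * \<rho> ^ n"
      by (simp add: add_divide_distrib algebra_simps)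
    finally show ?thesis .
  qed
  have "(\<lambda>n. c * ((1 + L) / (1 - \<rho>)) * U y + real m * c' * L * U y * \<rho> ^ n)
      \<longlonglongrightarrow> c * ((1 + L) / (1 - \<rho>)) * U y + real m * c' * L * U y * 0"
    using \<rho>_bounds by (intro tendsto_intros LIMSEQ_power_zero) auto
  then show ?thesis
    using bound by (intro LIMSEQ_le_const[where X="\<lambda>n. c * ((1 + L) / (1 - \<rho>)) * U y + real m * c' * L * U y * \<rho> ^ n"]) auto
qed

end

text \<open>The solution given by the Neumann series of \<open>Q\<close> depends on \<open>\<eta>\<close>, which need not be
  measurable in \<open>\<gamma>\<close>. The following approximate solution only involves the kernel.\<close>

definition poisson_avg :: "('a \<Rightarrow> 'a measure) \<Rightarrow> ('a \<Rightarrow> real) \<Rightarrow> nat \<Rightarrow> 'a \<Rightarrow> real" where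
  "poisson_avg K u N y = (\<Sum>m=1..N. \<Sum>k<m. (kernel_op K ^^ k) u y) / real N"

text \<open>This is (1 + L) / (1 - \<rho>) times 1 + b / \<delta>, the factor that passes from
  \<open>U\<close> to \<open>W\<close>, plus 1 for the extra term u in the residual of the averaged
  equation. It is spelled out in l, b and \<delta> so that it makes sense outside the locale and
  visibly does not depend on \<gamma>.\<close>

definition poisson_const :: "real \<Rightarrow> real \<Rightarrow> real \<Rightarrow> real" where
  "poisson_const l b \<delta> =
    (2 + b / \<delta> + b / (1 - l)) / (1 - (l + b / \<delta>) / (1 + b / \<delta>)) * (1 + b / \<delta>) + 1"

section \<open>Averaged solutions of the Poisson equation\<close>

context stationary_drift_minorization begin

context
  fixes c :: real and u :: "'a \<Rightarrow> real"
  assumes u_measurable: "u \<in> borel_measurable S"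
    and u_bound: "\<And>y. y \<in> space S \<Longrightarrow> \<bar>u y\<bar> \<le> c * W y"
    and u_centred: "(\<integral>y. u y \<partial>\<mu>) = 0"
begin

lemma c_nonneg: "0 \<le> c"
proof -
  obtain y where y: "y \<in> space S" using \<mu>.not_empty by auto
  show ?thesis using u_bound[OF y] W_ge_1[OF y] by (smt (verit) mult_neg_pos)
qed

lemma dominated_u: "dominated c u"
  unfolding dominated_def
proof (intro conjI ballI u_measurable)
  fix y assume "y \<in> space S"
  then show "\<bar>u y\<bar> \<le> c * U y"
    using u_bound[of y] c_nonneg b \<delta> by (auto simp: U_def distrib_left intro: order_trans)
qed

lemma partial_sums_bound_W:
  assumes y: "y \<in> space S"
  shows "\<bar>\<Sum>k<m. P_pow k u y\<bar> \<le> c * (poisson_const l b \<delta> - 1) * W y"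
proof -
  have "b / \<delta> * 1 \<le> b / \<delta> * W y"
    using W_ge_1[OF y] b \<delta> by (intro mult_left_mono) auto
  then have "U y \<le> (1 + b / \<delta>) * W y" by (simp add: U_def distrib_right)
  then have "c * ((1 + L) / (1 - \<rho>)) * U y \<le> c * ((1 + L) / (1 - \<rho>)) * ((1 + b / \<delta>) * W y)"
    using c_nonneg L_ge_1 \<rho>_bounds by (intro mult_left_mono) auto
  also have "\<dots> = c * (poisson_const l b \<delta> - 1) * W y"
    by (simp add: poisson_const_def \<rho>_def L_def B_def add.assoc)
  finally show ?thesis
    using partial_sums_bound[OF dominated_u u_centred y, of m] by simp
qed

lemma poisson_avg_bound:
  assumes y: "y \<in> space S"
  shows "\<bar>poisson_avg K u N y\<bar> \<le> c * poisson_const l b \<delta> * W y"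
proof -
  let ?R = "c * (poisson_const l b \<delta> - 1) * W y"
  have R: "0 \<le> ?R" using partial_sums_bound_W[OF y, of 0] by simp
  have "\<bar>\<Sum>m=1..N. \<Sum>k<m. P_pow k u y\<bar> \<le> real N * ?R"
    using sum_bounded_above[of "{1..N}" "\<lambda>m. \<bar>\<Sum>k<m. P_pow k u y\<bar>" ?R] partial_sums_bound_W[OF y]
    by (intro order_trans[OF sum_abs]) simp
  then have "\<bar>poisson_avg K u N y\<bar> \<le> ?R"
    using R by (cases "N = 0") (auto simp: poisson_avg_def abs_divide pos_divide_le_eq mult.commute)
  also have "\<dots> \<le> c * poisson_const l b \<delta> * W y"
    using c_nonneg W_nonneg[OF y] by (intro mult_right_mono mult_left_mono) auto
  finally show ?thesis .
qed

text \<open>For H_m, the sum of P^k u over k < m, one has H_m - P H_m = u - P^m u. Averaging over m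
  = 1..N leaves the mean of P u, ..., P^N u, which equals (H_(N+1) - u) / N and is small because
  partial sums are bounded.\<close>

lemma poisson_avg_equation:
  assumes y: "y \<in> space S" and N: "1 \<le> N"
  shows "\<bar>u y - (poisson_avg K u N y - kernel_op K (poisson_avg K u N) y)\<bar>
      \<le> c * poisson_const l b \<delta> * W y / real N"
proof -
  have P: "dominated (c * L) (P_pow k u)" for k by (rule dominated_P_pow[OF dominated_u])
  have H: "dominated (\<Sum>k<m. c * L) (\<lambda>y. \<Sum>k<m. P_pow k u y)" for m
    by (rule dominated_sum[OF P])
  have KH: "kernel_op K (\<lambda>y. \<Sum>k<m. P_pow k u y) y = (\<Sum>k<m. P_pow k u y) - u y + P_pow m u y" for m
  proof -
    have "kernel_op K (\<lambda>y. \<Sum>k<m. P_pow k u y) y = (\<Sum>k<m. P_pow (Suc k) u y)"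
      using kernel_op_sum[OF P y, where I="{..<m}"] by simp
    then show ?thesis
      using sum.lessThan_Suc[of "\<lambda>k. P_pow k u y" m] sum.lessThan_Suc_shift[of "\<lambda>k. P_pow k u y" m] by simp
  qed
  have "kernel_op K (poisson_avg K u N) y
      = kernel_op K (\<lambda>y. inverse (real N) * (\<Sum>m=1..N. \<Sum>k<m. P_pow k u y)) y"
    by (simp add: poisson_avg_def[abs_def] divide_inverse mult.commute)
  also have "\<dots> = inverse (real N) * (\<Sum>m=1..N. (\<Sum>k<m. P_pow k u y) - u y + P_pow m u y)"
    unfolding kernel_op_cmult using kernel_op_sum[OF H y, where I="{1..N}"] by (simp add: KH)
  also have "\<dots> = poisson_avg K u N y - u y + (\<Sum>m=1..N. P_pow m u y) / real N"
    using N by (simp add: poisson_avg_def sum.distrib sum_subtractf field_simps)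
  finally have "u y - (poisson_avg K u N y - kernel_op K (poisson_avg K u N) y) = (\<Sum>m=1..N. P_pow m u y) / real N"
    by simp
  also have "(\<Sum>m=1..N. P_pow m u y) = (\<Sum>k<Suc N. P_pow k u y) - u y"
    unfolding sum.lessThan_Suc_shift by (simp add: sum.atLeast1_atMost_eq)
  finally have "\<bar>u y - (poisson_avg K u N y - kernel_op K (poisson_avg K u N) y)\<bar>
      = \<bar>(\<Sum>k<Suc N. P_pow k u y) - u y\<bar> / real N"
    by (simp add: abs_divide)
  also have "\<dots> \<le> (c * (poisson_const l b \<delta> - 1) * W y + c * W y) / real N"
    using partial_sums_bound_W[OF y, of "Suc N"] u_bound[OF y] by (intro divide_right_mono) linarith+
  also have "\<dots> = c * poisson_const l b \<delta> * W y / real N"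
    by (simp add: algebra_simps)
  finally show ?thesis .
qed

end
end

section \<open>A strong law for martingale differences\<close>

lemma integrable_mult_of_squares:
  fixes f g :: "'a \<Rightarrow> real"
  assumes [measurable]: "f \<in> borel_measurable M" "g \<in> borel_measurable M"
    and f: "integrable M (\<lambda>x. (f x)\<^sup>2)" and g: "integrable M (\<lambda>x. (g x)\<^sup>2)"
  shows "integrable M (\<lambda>x. f x * g x)"
proof (rule Bochner_Integration.integrable_bound[OF Bochner_Integration.integrable_add[OF f g]])
  have "\<bar>a * b\<bar> \<le> a\<^sup>2 + b\<^sup>2" for a b :: real
  proof -
    have "0 \<le> (\<bar>a\<bar> - \<bar>b\<bar>)\<^sup>2" "0 \<le> a\<^sup>2" "0 \<le> b\<^sup>2" by auto
    moreover have "0 \<le> \<bar>a\<bar> * \<bar>b\<bar>" by simp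
    ultimately show ?thesis unfolding abs_mult power2_diff power2_abs by linarith
  qed
  then show "AE x in M. norm (f x * g x) \<le> norm ((f x)\<^sup>2 + (g x)\<^sup>2)" by simp
qed simp

locale martingale_differences = prob_space M for M :: "'a measure" +
  fixes F :: "nat \<Rightarrow> 'a measure" and D :: "nat \<Rightarrow> 'a \<Rightarrow> real"
  assumes subalgebra: "\<And>n. subalgebra M (F n)"
    and filtration: "\<And>m n. m \<le> n \<Longrightarrow> sets (F m) \<subseteq> sets (F n)"
    and adapted: "\<And>n. D n \<in> borel_measurable (F (Suc n))"
    and square_integrable: "\<And>n. integrable M (\<lambda>\<omega>. (D n \<omega>)\<^sup>2)"
    and centred: "\<And>n. AE \<omega> in M. real_cond_exp M (F n) (D n) \<omega> = 0"
begin

lemma space_F [simp]: "space (F n) = space M"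
  using subalgebra by (simp add: subalgebra_def)

lemma measurable_F: "f \<in> borel_measurable (F n) \<Longrightarrow> f \<in> borel_measurable M"
  by (rule measurable_from_subalg[OF subalgebra])

lemma measurable_F_mono: "f \<in> borel_measurable (F m) \<Longrightarrow> m \<le> n \<Longrightarrow> f \<in> borel_measurable (F n)"
  using filtration[of m n] by (auto simp: measurable_def)

lemma D_measurable [measurable]: "D n \<in> borel_measurable M"
  using adapted by (rule measurable_F)

definition T :: "nat \<Rightarrow> 'a \<Rightarrow> real" where "T n \<omega> = (\<Sum>k<n. D k \<omega>)"

lemma T_adapted: "T n \<in> borel_measurable (F n)"
  unfolding T_def by (intro borel_measurable_sum measurable_F_mono[OF adapted]) auto

lemma T_measurable [measurable]: "T n \<in> borel_measurable M"
  using T_adapted by (rule measurable_F)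

lemma integrable_T_square: "integrable M (\<lambda>\<omega>. (T n \<omega>)\<^sup>2)"
proof (induction n)
  case (Suc n)
  have "integrable M (\<lambda>\<omega>. (T n \<omega>)\<^sup>2 + 2 * (T n \<omega> * D n \<omega>) + (D n \<omega>)\<^sup>2)"
    using Suc square_integrable integrable_mult_of_squares[of "T n" M "D n"] by simp
  then show ?case by (simp add: T_def power2_sum algebra_simps)
qed (simp add: T_def)

lemma orthogonal:
  assumes Z: "Z \<in> borel_measurable (F n)" and Z2: "integrable M (\<lambda>\<omega>. (Z \<omega>)\<^sup>2)"
  shows "integrable M (\<lambda>\<omega>. Z \<omega> * D n \<omega>)" "(\<integral>\<omega>. Z \<omega> * D n \<omega> \<partial>M) = 0"
proof -
  have [measurable]: "Z \<in> borel_measurable M" by (rule measurable_F[OF Z])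
  show int: "integrable M (\<lambda>\<omega>. Z \<omega> * D n \<omega>)"
    using Z2 square_integrable by (intro integrable_mult_of_squares) auto
  interpret finite_measure_subalgebra M "F n"
    by unfold_locales (rule subalgebra)
  have "(\<integral>\<omega>. Z \<omega> * D n \<omega> \<partial>M) = (\<integral>\<omega>. Z \<omega> * real_cond_exp M (F n) (D n) \<omega> \<partial>M)"
    using int Z by (intro real_cond_exp_intg(2)[symmetric]) auto
  also have "\<dots> = (\<integral>\<omega>. 0 \<partial>M)"
    using centred[of n] by (intro integral_cong_AE) (auto simp: borel_measurable_cond_exp2)
  finally show "(\<integral>\<omega>. Z \<omega> * D n \<omega> \<partial>M) = 0" by simp
qed

lemma integrable_indicator_mult:
  fixes f :: "'a \<Rightarrow> real" shows "A \<in> sets M \<Longrightarrow> integrable M f \<Longrightarrow> integrable M (\<lambda>\<omega>. indicator A \<omega> * f \<omega>)"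
  using integrable_mult_indicator[of A M f] by simp

text \<open>Localised to an event of \<open>F n\<close>, because the maximal inequality compares
  \<open>T k\<close> with \<open>T n\<close> on the event that a level is first reached at time k.
  The cross term vanishes since indicator times \<open>T n\<close> is known at time n.\<close>

lemma localized_square_Suc:
  assumes A: "A \<in> sets (F n)"
  shows "(\<integral>\<omega>. indicator A \<omega> * (T (Suc n) \<omega>)\<^sup>2 \<partial>M)
    = (\<integral>\<omega>. indicator A \<omega> * (T n \<omega>)\<^sup>2 \<partial>M) + (\<integral>\<omega>. indicator A \<omega> * (D n \<omega>)\<^sup>2 \<partial>M)"
proof -
  have AM [measurable]: "A \<in> sets M" using A subalgebra by (auto simp: subalgebra_def)
  have Z: "(\<lambda>\<omega>. indicator A \<omega> * T n \<omega>) \<in> borel_measurable (F n)"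
    using A T_adapted by (intro borel_measurable_times borel_measurable_indicator)
  have "(indicator A \<omega> * T n \<omega>)\<^sup>2 = indicator A \<omega> * (T n \<omega>)\<^sup>2" for \<omega>
    by (simp add: indicator_def)
  then have Z2: "integrable M (\<lambda>\<omega>. (indicator A \<omega> * T n \<omega>)\<^sup>2)"
    using integrable_indicator_mult[OF AM integrable_T_square] by simp
  note orth = orthogonal[OF Z Z2]
  have "(\<integral>\<omega>. indicator A \<omega> * (T (Suc n) \<omega>)\<^sup>2 \<partial>M)
      = (\<integral>\<omega>. indicator A \<omega> * (T n \<omega>)\<^sup>2 + 2 * (indicator A \<omega> * T n \<omega> * D n \<omega>) + indicator A \<omega> * (D n \<omega>)\<^sup>2 \<partial>M)"
    by (intro Bochner_Integration.integral_cong) (auto simp: T_def power2_sum algebra_simps)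
  also have "\<dots> = (\<integral>\<omega>. indicator A \<omega> * (T n \<omega>)\<^sup>2 \<partial>M) + 2 * (\<integral>\<omega>. indicator A \<omega> * T n \<omega> * D n \<omega> \<partial>M)
      + (\<integral>\<omega>. indicator A \<omega> * (D n \<omega>)\<^sup>2 \<partial>M)"
    using orth(1) integrable_indicator_mult[OF AM integrable_T_square] integrable_indicator_mult[OF AM square_integrable]
    by simp
  finally show ?thesis using orth(2) by simp
qed

lemma localized_square_mono:
  assumes A: "A \<in> sets (F k)"
  shows "k \<le> n \<Longrightarrow> (\<integral>\<omega>. indicator A \<omega> * (T k \<omega>)\<^sup>2 \<partial>M) \<le> (\<integral>\<omega>. indicator A \<omega> * (T n \<omega>)\<^sup>2 \<partial>M)"
proof (induction n rule: dec_induct)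
  case (step n)
  have "0 \<le> (\<integral>\<omega>. indicator A \<omega> * (D n \<omega>)\<^sup>2 \<partial>M)"
    by (intro integral_nonneg_AE) auto
  moreover have "A \<in> sets (F n)" using A filtration[OF step(1)] by auto
  ultimately show ?case
    using step(3) localized_square_Suc[of A n] by linarith
qed simp

lemma expectation_T_square: "(\<integral>\<omega>. (T n \<omega>)\<^sup>2 \<partial>M) = (\<Sum>k<n. \<integral>\<omega>. (D k \<omega>)\<^sup>2 \<partial>M)"
proof (induction n)
  case (Suc n)
  have *: "(\<integral>\<omega>. indicator (space M) \<omega> * f \<omega> \<partial>M) = (\<integral>\<omega>. f \<omega> \<partial>M)" for f :: "'a \<Rightarrow> real"
    by (intro Bochner_Integration.integral_cong) auto
  show ?case
    using localized_square_Suc[of "space M" n] Suc sets.top[of "F n"] by (simp add: *)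
qed (simp add: T_def)

text \<open>Kolmogorov's inequality. The event is split by the first time k at which the level is
  reached; each piece belongs to \<open>F k\<close>, so passing from \<open>T k\<close> to
  \<open>T n\<close> on it can only increase the mean square.\<close>

lemma maximal_inequality:
  assumes t: "0 < t"
  shows "t\<^sup>2 * prob {\<omega>\<in>space M. \<exists>k\<le>n. t \<le> \<bar>T k \<omega>\<bar>} \<le> (\<Sum>k<n. \<integral>\<omega>. (D k \<omega>)\<^sup>2 \<partial>M)"
proof -
  define A where "A k = {\<omega>\<in>space M. t \<le> \<bar>T k \<omega>\<bar> \<and> (\<forall>i<k. \<bar>T i \<omega>\<bar> < t)}" for k
  have AF: "A k \<in> sets (F k)" for k
  proof -
    have T: "(\<lambda>\<omega>. \<bar>T i \<omega>\<bar>) \<in> borel_measurable (F k)" if "i \<le> k" for i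
      by (intro borel_measurable_abs measurable_F_mono[OF T_adapted that])
    have "{\<omega>\<in>space (F k). t \<le> \<bar>T k \<omega>\<bar> \<and> (\<forall>i\<in>{..<k}. \<bar>T i \<omega>\<bar> < t)} \<in> sets (F k)"
      using T by (intro sets.sets_Collect_conj sets.sets_Collect_finite_All borel_measurable_le borel_measurable_less) auto
    then show ?thesis by (simp add: A_def lessThan_def Ball_def)
  qed
  have AM: "A k \<in> events" for k using AF[of k] subalgebra[of k] by (auto simp: subalgebra_def)
  have disj: "disjoint_family_on A {..n}"
    unfolding disjoint_family_on_def
  proof (intro ballI impI)
    fix i j :: nat assume "i \<noteq> j"
    then consider "i < j" | "j < i" by linarith
    then show "A i \<inter> A j = {}" by cases (auto simp: A_def dest: leD)
  qed
  have "{\<omega>\<in>space M. \<exists>k\<le>n. t \<le> \<bar>T k \<omega>\<bar>} = (\<Union>k\<le>n. A k)"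
  proof (intro equalityI subsetI)
    fix \<omega> assume \<omega>: "\<omega> \<in> {\<omega>\<in>space M. \<exists>k\<le>n. t \<le> \<bar>T k \<omega>\<bar>}"
    define k where "k = (LEAST k. t \<le> \<bar>T k \<omega>\<bar>)"
    from \<omega> obtain j where j: "j \<le> n" "t \<le> \<bar>T j \<omega>\<bar>" by auto
    have "t \<le> \<bar>T k \<omega>\<bar>" unfolding k_def using j(2) by (rule LeastI)
    moreover have "k \<le> n" unfolding k_def using j Least_le[of "\<lambda>k. t \<le> \<bar>T k \<omega>\<bar>" j] by simp
    moreover have "\<bar>T i \<omega>\<bar> < t" if "i < k" for i
      using not_less_Least[OF that[unfolded k_def]] by simp
    ultimately show "\<omega> \<in> (\<Union>k\<le>n. A k)" using \<omega> by (auto simp: A_def)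
  qed (auto simp: A_def)
  then have "t\<^sup>2 * prob {\<omega>\<in>space M. \<exists>k\<le>n. t \<le> \<bar>T k \<omega>\<bar>} = (\<Sum>k\<le>n. t\<^sup>2 * prob (A k))"
    using AM disj by (simp add: finite_measure_finite_Union sum_distrib_left image_subset_iff)
  also have "\<dots> \<le> (\<Sum>k\<le>n. \<integral>\<omega>. indicator (A k) \<omega> * (T n \<omega>)\<^sup>2 \<partial>M)"
  proof (rule sum_mono)
    fix k assume k: "k \<in> {..n}"
    have "t\<^sup>2 * prob (A k) = (\<integral>\<omega>. indicator (A k) \<omega> * t\<^sup>2 \<partial>M)"
      using AM[of k] sets.sets_into_space[OF AM[of k]] by (simp add: Int_absorb2)
    also have "\<dots> \<le> (\<integral>\<omega>. indicator (A k) \<omega> * (T k \<omega>)\<^sup>2 \<partial>M)"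
    proof (rule integral_mono)
      show "indicator (A k) \<omega> * t\<^sup>2 \<le> indicator (A k) \<omega> * (T k \<omega>)\<^sup>2" for \<omega>
        using t power_mono[of t "\<bar>T k \<omega>\<bar>" 2] by (auto simp: indicator_def A_def)
    qed (use integrable_indicator_mult[OF AM integrable_T_square] integrable_indicator_mult[OF AM integrable_const] in auto)
    also have "\<dots> \<le> (\<integral>\<omega>. indicator (A k) \<omega> * (T n \<omega>)\<^sup>2 \<partial>M)"
      using k by (intro localized_square_mono AF) simp
    finally show "t\<^sup>2 * prob (A k) \<le> (\<integral>\<omega>. indicator (A k) \<omega> * (T n \<omega>)\<^sup>2 \<partial>M)" .
  qed
  also have "\<dots> = (\<integral>\<omega>. indicator (\<Union>k\<le>n. A k) \<omega> * (T n \<omega>)\<^sup>2 \<partial>M)"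
    using integrable_indicator_mult[OF AM integrable_T_square] disj
    by (simp add: Bochner_Integration.integral_sum[symmetric] sum_distrib_right[symmetric] indicator_UN_disjoint)
  also have "\<dots> \<le> (\<integral>\<omega>. (T n \<omega>)\<^sup>2 \<partial>M)"
    using AM by (intro integral_mono integrable_indicator_mult integrable_T_square) (auto simp: indicator_def)
  finally show ?thesis by (simp add: expectation_T_square)
qed

text \<open>Dyadic blocks: by the maximal inequality the probability that the level c 2^(i s) is
  reached up to time 2^(i+1) is of order 2^(i (1 - 2 s)). This is summable for s > 1/2, and
  Borel-Cantelli applies.\<close>

theorem strong_law:
  assumes bound: "\<And>n. (\<integral>\<omega>. (D n \<omega>)\<^sup>2 \<partial>M) \<le> b" and s: "s > 1 / 2"
  shows "AE \<omega> in M. (\<lambda>n. (\<Sum>k<n. D k \<omega>) / real n powr s) \<longlonglongrightarrow> 0"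
proof -
  have b: "0 \<le> b" using bound[of 0] by (rule order_trans[rotated]) simp
  have ev: "AE \<omega> in M. \<forall>\<^sub>F n in sequentially. \<bar>T n \<omega>\<bar> < c * real n powr s" if c: "0 < c" for c
  proof -
    define E where "E i = {\<omega>\<in>space M. \<exists>k\<le>2 ^ Suc i. c * (2 ^ i) powr s \<le> \<bar>T k \<omega>\<bar>}" for i :: nat
    have E [measurable]: "E i \<in> events" for i unfolding E_def by measurable
    have prob_E: "prob (E i) \<le> 2 * b / c\<^sup>2 * (2 powr (1 - 2 * s)) ^ i" for i
    proof -
      have t: "0 < c * (2 ^ i) powr s" using c by simp
      have "(c * (2 ^ i) powr s)\<^sup>2 * prob (E i) \<le> (\<Sum>k<(2::nat) ^ Suc i. \<integral>\<omega>. (D k \<omega>)\<^sup>2 \<partial>M)"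
        unfolding E_def by (rule maximal_inequality[OF t])
      also have "\<dots> \<le> (\<Sum>k<(2::nat) ^ Suc i. b)" by (intro sum_mono bound)
      finally have "prob (E i) \<le> b * 2 ^ Suc i / (c * (2 ^ i) powr s)\<^sup>2"
        using zero_less_power[OF t, of 2] by (simp add: pos_le_divide_eq mult.commute)
      also have "\<dots> = 2 * b / c\<^sup>2 * (2 ^ i / ((2 ^ i) powr s)\<^sup>2)"
        by (simp add: power_mult_distrib)
      also have "2 ^ i / ((2 ^ i) powr s)\<^sup>2 = (2 powr (1 - 2 * s)) ^ i"
        by (simp add: powr_realpow[symmetric] powr_powr powr_add[symmetric] powr_diff[symmetric] power2_eq_square algebra_simps
          del: powr_realpow)
      finally show ?thesis .
    qed
    have "summable (\<lambda>i. 2 * b / c\<^sup>2 * (2 powr (1 - 2 * s)) ^ i)"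
    proof (intro summable_mult summable_geometric)
      have "2 powr (1 - 2 * s) < 2 powr 0" using s by (intro powr_less_mono) auto
      then show "norm (2 powr (1 - 2 * s)) < (1::real)" by simp
    qed
    then have "summable (\<lambda>i. prob (E i))"
      by (rule summable_comparison_test'[where N=0]) (use prob_E in simp)
    then have "AE \<omega> in M. \<forall>\<^sub>F i in sequentially. \<omega> \<in> space M - E i"
      by (intro borel_cantelli_AE1) (auto simp: emeasure_eq_measure)
    then show ?thesis
    proof eventually_elim
      case (elim \<omega>)
      then obtain N where N: "\<And>i. i \<ge> N \<Longrightarrow> \<omega> \<in> space M - E i"
        by (auto simp: eventually_sequentially)
      show ?case
        unfolding eventually_sequentially
      proof (intro exI allI impI)
        fix n :: nat assume n: "2 ^ N \<le> n"
        then have n0: "0 < n" using less_le_trans[of 0 "2 ^ N" n] by simp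
        obtain i where i: "2 ^ i \<le> n" "n < 2 ^ Suc i" using ex_power_ivl1[of 2 n] n0 by auto
        have "N \<le> i"
        proof (rule ccontr)
          assume "\<not> N \<le> i"
          then have "(2::nat) ^ Suc i \<le> 2 ^ N" by (intro power_increasing) auto
          then show False using i n by linarith
        qed
        then have "\<bar>T n \<omega>\<bar> < c * (2 ^ i) powr s"
          using N[of i] i by (auto simp: E_def not_le dest!: spec[of _ n])
        also have "\<dots> \<le> c * real n powr s"
        proof (intro mult_left_mono powr_mono2)
          show "2 ^ i \<le> real n" using i(1) by (metis of_nat_le_iff of_nat_numeral of_nat_power)
        qed (use c s in auto)
        finally show "\<bar>T n \<omega>\<bar> < c * real n powr s" .
      qed
    qed
  qed
  \<comment> \<open>Only countably many values of c are used, so that the exceptional null sets can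
    be united.\<close>
  have "AE \<omega> in M. \<forall>m::nat. \<forall>\<^sub>F n in sequentially. \<bar>T n \<omega>\<bar> < inverse (real (Suc m)) * real n powr s"
    unfolding AE_all_countable using ev by simp
  then show ?thesis
  proof eventually_elim
    case (elim \<omega>)
    show ?case
    proof (rule tendstoI)
      fix e :: real assume "0 < e"
      then obtain m where m: "inverse (real (Suc m)) < e" using reals_Archimedean by blast
      show "\<forall>\<^sub>F n in sequentially. dist ((\<Sum>k<n. D k \<omega>) / real n powr s) 0 < e"
        using elim[rule_format, of m] eventually_gt_at_top[of 0]
      proof eventually_elim
        case (elim n)
        then have "\<bar>T n \<omega>\<bar> / real n powr s < inverse (real (Suc m))"
          by (simp add: pos_divide_less_eq)
        then show ?case using m by (simp add: T_def)
      qed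
    qed
  qed
qed

end

section \<open>Conditional laws along the chain\<close>

context mcmc_family begin

text \<open>The chain evaluates the kernel at a random parameter, so measurability is needed in the
  pair, and as a map into measures rather than set by set.\<close>

lemma joint_kernel: "(\<lambda>(y, \<gamma>). P \<gamma> y) \<in> borel \<Otimes>\<^sub>M MI \<rightarrow>\<^sub>M prob_algebra borel"
proof (rule measurable_prob_algebra_generated[where \<Omega>=UNIV and G="sets borel"])
  show "sets borel = sigma_sets UNIV (sets borel)"
    by (rule sets.sigma_sets_eq[of borel, unfolded space_borel, symmetric])
  show "Int_stable (sets borel)" by (rule sets.Int_stable)
  fix z :: "('x \<times> 'f) \<times> 'i" assume "z \<in> space (borel \<Otimes>\<^sub>M MI)"
  then have "P (snd z) (fst z) \<in> space (prob_algebra borel)"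
    using measurable_space[OF kernel[of "snd z"], of "fst z"] by (auto simp: space_pair_measure)
  then show "prob_space (case z of (y, \<gamma>) \<Rightarrow> P \<gamma> y)" "sets (case z of (y, \<gamma>) \<Rightarrow> P \<gamma> y) = sets borel"
    by (auto simp: space_prob_algebra split_beta)
next
  fix A :: "('x \<times> 'f) set" assume "A \<in> sets borel"
  then show "(\<lambda>a. emeasure (case a of (y, \<gamma>) \<Rightarrow> P \<gamma> y) A) \<in> borel_measurable (borel \<Otimes>\<^sub>M MI)"
    using kernel_measurable[of A] by (simp add: split_beta')
qed simp

lemma prob_space_P: "\<gamma> \<in> space MI \<Longrightarrow> prob_space (P \<gamma> y)"
  and sets_P: "\<gamma> \<in> space MI \<Longrightarrow> sets (P \<gamma> y) = sets borel"
  using measurable_space[OF kernel[of \<gamma>], of y] by (auto simp: space_prob_algebra)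

lemma kernel_op_jointly_measurable:
  assumes F: "(\<lambda>(y, \<gamma>). F \<gamma> y) \<in> borel_measurable (borel \<Otimes>\<^sub>M MI)"
  shows "(\<lambda>(y, \<gamma>). kernel_op (P \<gamma>) (F \<gamma>) y) \<in> borel_measurable (borel \<Otimes>\<^sub>M MI)"
proof -
  have "(\<lambda>z. \<integral>y'. F (snd z) y' \<partial>(case z of (y, \<gamma>) \<Rightarrow> P \<gamma> y)) \<in> borel_measurable (borel \<Otimes>\<^sub>M MI)"
  proof (rule integral_measurable_subprob_algebra2)
    have "(\<lambda>x. (\<lambda>(y, \<gamma>). F \<gamma> y) (snd x, snd (fst x))) \<in> borel_measurable ((borel \<Otimes>\<^sub>M MI) \<Otimes>\<^sub>M borel)"
      by (rule measurable_compose[OF _ F]) measurable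
    then show "(\<lambda>(z, y). F (snd z) y) \<in> borel_measurable ((borel \<Otimes>\<^sub>M MI) \<Otimes>\<^sub>M borel)"
      by (simp add: split_beta')
  qed (rule measurable_prob_algebraD[OF joint_kernel])
  then show ?thesis by (simp add: kernel_op_def split_beta')
qed

lemma kernel_op_pow_jointly_measurable:
  assumes u: "u \<in> borel_measurable borel"
  shows "(\<lambda>(y, \<gamma>). (kernel_op (P \<gamma>) ^^ k) u y) \<in> borel_measurable (borel \<Otimes>\<^sub>M MI)"
proof (induction k)
  case 0
  show ?case using measurable_compose[OF measurable_fst u] by (simp add: split_beta')
next
  case (Suc k)
  show ?case using kernel_op_jointly_measurable[OF Suc] by simp
qed

end

section \<open>The history of the chain and the law of its next state\<close>

context air_mcmc begin

sublocale prob_space M by (rule prob_M)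

abbreviation H :: "nat \<Rightarrow> 'w measure" where "H \<equiv> history M MI Y \<Gamma>"

lemma space_history [simp]: "space (H n) = space M"
  and sets_history: "sets (H n) = sigma_sets (space M)
     ({Y i -` B \<inter> space M | i B. i \<le> n \<and> B \<in> sets borel} \<union>
      {\<Gamma> i -` B \<inter> space M | i B. i \<le> n \<and> B \<in> sets MI})"
proof -
  have "({Y i -` B \<inter> space M | i B. i \<le> n \<and> B \<in> sets borel} \<union>
      {\<Gamma> i -` B \<inter> space M | i B. i \<le> n \<and> B \<in> sets MI}) \<subseteq> Pow (space M)" by auto
  note * = space_measure_of[OF this] sets_measure_of[OF this]
  show "space (H n) = space M" unfolding history_def by (rule *(1))
  show "sets (H n) = sigma_sets (space M)
     ({Y i -` B \<inter> space M | i B. i \<le> n \<and> B \<in> sets borel} \<union>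
      {\<Gamma> i -` B \<inter> space M | i B. i \<le> n \<and> B \<in> sets MI})" unfolding history_def by (rule *(2))
qed

lemma subalgebra_history: "subalgebra M (H n)"
  unfolding subalgebra_def sets_history space_history
  using measurable_sets[OF Y_measurable] measurable_sets[OF \<Gamma>_measurable]
  by (intro conjI refl sets.sigma_sets_subset) blast

lemma history_mono: "m \<le> n \<Longrightarrow> sets (H m) \<subseteq> sets (H n)"
  unfolding sets_history by (intro sigma_sets_mono' Un_mono) (blast intro: order_trans)+

lemma Y_adapted: "i \<le> n \<Longrightarrow> Y i \<in> H n \<rightarrow>\<^sub>M borel"
  and \<Gamma>_adapted: "i \<le> n \<Longrightarrow> \<Gamma> i \<in> H n \<rightarrow>\<^sub>M MI"
proof -
  assume i: "i \<le> n"
  show "Y i \<in> H n \<rightarrow>\<^sub>M borel"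
  proof (rule measurableI)
    fix B :: "('x \<times> 'f) set" assume "B \<in> sets borel"
    then show "Y i -` B \<inter> space (H n) \<in> sets (H n)"
      unfolding sets_history space_history using i by (intro sigma_sets.Basic) blast
  qed simp
  show "\<Gamma> i \<in> H n \<rightarrow>\<^sub>M MI"
  proof (rule measurableI)
    fix B assume "B \<in> sets MI"
    then show "\<Gamma> i -` B \<inter> space (H n) \<in> sets (H n)"
      unfolding sets_history space_history using i by (intro sigma_sets.Basic) blast
  qed (use measurable_space[OF \<Gamma>_measurable] in simp)
qed

abbreviation Ker :: "nat \<Rightarrow> 'w \<Rightarrow> ('x \<times> 'f) measure" where
  "Ker n \<omega> \<equiv> P (\<Gamma> n \<omega>) (Y n \<omega>)"

lemma Ker_measurable: "Ker n \<in> H n \<rightarrow>\<^sub>M prob_algebra borel"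
proof -
  have "(\<lambda>\<omega>. (Y n \<omega>, \<Gamma> n \<omega>)) \<in> H n \<rightarrow>\<^sub>M borel \<Otimes>\<^sub>M MI"
    using Y_adapted[of n n] \<Gamma>_adapted[of n n] by (intro measurable_Pair) auto
  from measurable_compose[OF this joint_kernel] show ?thesis by simp
qed

lemma \<Gamma>_space: "\<omega> \<in> space M \<Longrightarrow> \<Gamma> n \<omega> \<in> space MI"
  using \<Gamma>_measurable by (rule measurable_space)

text \<open>Testing the conditional probability on an event of the past turns
  \<open>transition\<close> into an identity for rectangles, the input for
  \<open>disintegration\<close>.\<close>

lemma transition_rectangle:
  assumes A: "A \<in> sets (H n)" and B: "B \<in> sets borel"
  shows "emeasure M (A \<inter> Y (Suc n) -` B) = (\<integral>\<^sup>+\<omega>. indicator A \<omega> * emeasure (Ker n \<omega>) B \<partial>M)"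
proof -
  interpret finite_measure_subalgebra M "H n" by unfold_locales (rule subalgebra_history)
  have AM: "A \<in> events" using A subalgebra_history by (auto simp: subalgebra_def)
  have AB: "A \<inter> Y (Suc n) -` B \<in> events"
  proof -
    have "A \<inter> Y (Suc n) -` B = A \<inter> (Y (Suc n) -` B \<inter> space M)"
      using sets.sets_into_space[OF AM] by auto
    then show ?thesis
      using sets.Int[OF AM measurable_sets[OF Y_measurable B]] by metis
  qed
  let ?I = "indicator (Y (Suc n) -` B \<inter> space M) :: 'w \<Rightarrow> real"
  have I: "integrable M ?I"
    using measurable_sets[OF Y_measurable B] by (simp add: integrable_indicator_iff emeasure_eq_measure)
  have Km: "(\<lambda>\<omega>. measure (Ker n \<omega>) B) \<in> borel_measurable M"
    using measure_measurable_prob_algebra2 Ker_measurable B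
    by (intro measurable_from_subalg[OF subalgebra_history] measurable_compose[OF Ker_measurable] measure_measurable_prob_algebra2) auto
  have "prob (A \<inter> Y (Suc n) -` B) = (\<integral>\<omega>\<in>A. ?I \<omega> \<partial>M)"
  proof -
    have "(\<integral>\<omega>\<in>A. ?I \<omega> \<partial>M) = (\<integral>\<omega>. indicator (A \<inter> Y (Suc n) -` B) \<omega> \<partial>M)"
      unfolding set_lebesgue_integral_def
      by (intro Bochner_Integration.integral_cong) (auto simp: indicator_def)
    then show ?thesis
      using sets.sets_into_space[OF AB] by (simp add: Int_absorb2)
  qed
  also have "\<dots> = (\<integral>\<omega>\<in>A. real_cond_exp M (H n) ?I \<omega> \<partial>M)"
    by (rule real_cond_exp_intA[OF I A])
  also have "\<dots> = (\<integral>\<omega>\<in>A. measure (Ker n \<omega>) B \<partial>M)"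
    unfolding set_lebesgue_integral_def
    using transition[OF B, of n] AM Km
    by (intro integral_cong_AE) (auto simp: borel_measurable_cond_exp2)
  finally have "emeasure M (A \<inter> Y (Suc n) -` B) = ennreal (\<integral>\<omega>. indicator A \<omega> * measure (Ker n \<omega>) B \<partial>M)"
    by (simp add: emeasure_eq_measure set_lebesgue_integral_def)
  also have "\<dots> = (\<integral>\<^sup>+\<omega>. ennreal (indicator A \<omega> * measure (Ker n \<omega>) B) \<partial>M)"
    using AM Km prob_space.prob_le_1[OF prob_space_P[OF \<Gamma>_space]]
    by (intro nn_integral_eq_integral[symmetric] integrable_const_bound[where B=1]) (auto simp: indicator_def)
  also have "\<dots> = (\<integral>\<^sup>+\<omega>. indicator A \<omega> * emeasure (Ker n \<omega>) B \<partial>M)"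
    using prob_space_P[OF \<Gamma>_space]
    by (intro nn_integral_cong) (auto simp: indicator_def finite_measure.emeasure_eq_measure prob_space.finite_measure)
  finally show ?thesis .
qed

text \<open>\<open>transition\<close> concerns a fixed set, whereas integrands such as
  \<open>F (\<Gamma> n \<omega>) (Y (Suc n) \<omega>)\<close> also depend on the past. The law of
  the pair (past, next state) and the law built from the kernel agree on rectangles, an
  intersection-stable generator, hence everywhere.\<close>

lemma disintegration:
  assumes F: "F \<in> borel_measurable (H n \<Otimes>\<^sub>M borel)"
  shows "(\<integral>\<^sup>+\<omega>. F (\<omega>, Y (Suc n) \<omega>) \<partial>M) = (\<integral>\<^sup>+\<omega>. (\<integral>\<^sup>+y. F (\<omega>, y) \<partial>Ker n \<omega>) \<partial>M)"
proof -
  let ?N = "H n \<Otimes>\<^sub>M (borel :: ('x \<times> 'f) measure)"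
  let ?E = "{A \<times> B | A B. A \<in> sets (H n) \<and> B \<in> sets (borel :: ('x \<times> 'f) measure)}"
  have id: "(\<lambda>\<omega>. \<omega>) \<in> M \<rightarrow>\<^sub>M H n"
    using subalgebra_history[of n] by (auto simp: measurable_def subalgebra_def intro!: sets.Int)
  have pair: "(\<lambda>\<omega>. (\<omega>, Y (Suc n) \<omega>)) \<in> M \<rightarrow>\<^sub>M ?N"
    using id Y_measurable by (intro measurable_Pair) auto
  have Ker: "Ker n \<in> M \<rightarrow>\<^sub>M subprob_algebra borel"
    using Ker_measurable[THEN measurable_prob_algebraD] by (rule measurable_from_subalg[OF subalgebra_history])
  define L where "L \<omega> = distr (Ker n \<omega>) ?N (Pair \<omega>)" for \<omega>
  have L: "L \<in> M \<rightarrow>\<^sub>M subprob_algebra ?N"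
    unfolding L_def
  proof (rule measurable_distr2[OF _ Ker])
    have "(\<lambda>x. (fst x, snd x)) \<in> M \<Otimes>\<^sub>M borel \<rightarrow>\<^sub>M ?N"
      using measurable_compose[OF measurable_fst id] by (intro measurable_Pair) auto
    then show "(\<lambda>(x, y). (x, y)) \<in> M \<Otimes>\<^sub>M borel \<rightarrow>\<^sub>M ?N" by (simp add: split_beta')
  qed
  have Pair: "Pair \<omega> \<in> Ker n \<omega> \<rightarrow>\<^sub>M ?N" if "\<omega> \<in> space M" for \<omega>
    using that sets_P[OF \<Gamma>_space[OF that]]
    by (auto cong: measurable_cong_sets intro!: measurable_Pair1')
  have "distr M ?N (\<lambda>\<omega>. (\<omega>, Y (Suc n) \<omega>)) = M \<bind> L"
  proof (rule measure_eqI_generator_eq[where E="?E" and A="\<lambda>_. space M \<times> UNIV" and \<Omega>="space M \<times> UNIV"])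
    show "Int_stable ?E" by (rule Int_stable_pair_measure_generator)
    show "?E \<subseteq> Pow (space M \<times> UNIV)"
      using sets.sets_into_space[of _ "H n"] by auto
    show "sets (distr M ?N (\<lambda>\<omega>. (\<omega>, Y (Suc n) \<omega>))) = sigma_sets (space M \<times> UNIV) ?E"
      by (simp add: sets_pair_measure)
    have "sets (M \<bind> L) = sets ?N"
      by (rule sets_bind) (use L not_empty in \<open>auto simp: L_def\<close>)
    then show "sets (M \<bind> L) = sigma_sets (space M \<times> UNIV) ?E"
      by (simp add: sets_pair_measure)
    show "range (\<lambda>_::nat. space M \<times> UNIV) \<subseteq> ?E"
    proof -
      have "space M \<times> UNIV \<in> ?E" using sets.top[of "H n"] by (force simp del: sets.top)
      then show ?thesis by auto
    qed
    show "emeasure (distr M ?N (\<lambda>\<omega>. (\<omega>, Y (Suc n) \<omega>))) (space M \<times> UNIV) \<noteq> \<infinity>" for i :: nat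
      using prob_space.emeasure_le_1[OF prob_space_distr[OF pair]] by (metis ennreal_one_less_top infinity_ennreal_def leD)
    fix X assume "X \<in> ?E"
    then obtain A B where X: "X = A \<times> B" and A: "A \<in> sets (H n)" and B: "B \<in> sets (borel :: ('x \<times> 'f) measure)" by auto
    have XN: "X \<in> sets ?N" using A B X by auto
    have "emeasure (distr M ?N (\<lambda>\<omega>. (\<omega>, Y (Suc n) \<omega>))) X = emeasure M (A \<inter> Y (Suc n) -` B)"
      using XN A sets.sets_into_space[OF A]
      by (subst emeasure_distr[OF pair]) (auto simp: X intro!: arg_cong2[where f=emeasure])
    also have "\<dots> = (\<integral>\<^sup>+\<omega>. indicator A \<omega> * emeasure (Ker n \<omega>) B \<partial>M)"
      by (rule transition_rectangle[OF A B])
    also have "\<dots> = (\<integral>\<^sup>+\<omega>. emeasure (L \<omega>) X \<partial>M)"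
    proof (rule nn_integral_cong)
      fix \<omega> assume \<omega>: "\<omega> \<in> space M"
      have [simp]: "space (Ker n \<omega>) = UNIV"
        using sets_eq_imp_space_eq[OF sets_P[OF \<Gamma>_space[OF \<omega>]]] by simp
      have "Pair \<omega> -` X = (if \<omega> \<in> A then B else {})" by (auto simp: X)
      then show "indicator A \<omega> * emeasure (Ker n \<omega>) B = emeasure (L \<omega>) X"
        using XN by (simp add: L_def emeasure_distr[OF Pair[OF \<omega>]] indicator_def)
    qed
    also have "\<dots> = emeasure (M \<bind> L) X"
      using emeasure_bind[OF not_empty L XN] by simp
    finally show "emeasure (distr M ?N (\<lambda>\<omega>. (\<omega>, Y (Suc n) \<omega>))) X = emeasure (M \<bind> L) X" .
  qed auto
  then have "(\<integral>\<^sup>+\<omega>. F (\<omega>, Y (Suc n) \<omega>) \<partial>M) = (\<integral>\<^sup>+z. F z \<partial>(M \<bind> L))"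
    using F pair by (subst nn_integral_distr[symmetric]) auto
  also have "\<dots> = (\<integral>\<^sup>+\<omega>. (\<integral>\<^sup>+z. F z \<partial>L \<omega>) \<partial>M)"
    by (rule nn_integral_bind[OF F L])
  also have "\<dots> = (\<integral>\<^sup>+\<omega>. (\<integral>\<^sup>+y. F (\<omega>, y) \<partial>Ker n \<omega>) \<partial>M)"
    unfolding L_def using F by (intro nn_integral_cong nn_integral_distr Pair) auto
  finally show ?thesis .
qed

end

section \<open>Adaptation times\<close>

text \<open>Discrete form of an integral comparison: summed up to m, it bounds the sum of j^\<beta>
  below by m^(1+\<beta>) / (1+\<beta>).\<close>

lemma powr_Suc_le:
  fixes \<beta> :: real assumes "0 < \<beta>"
  shows "real (Suc m) powr (1 + \<beta>) - real m powr (1 + \<beta>) \<le> (1 + \<beta>) * real (Suc m) powr \<beta>"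
proof (cases "m = 0")
  case True
  then show ?thesis using assms by simp
next
  case False
  have "\<exists>z>real m. z < real (Suc m) \<and> real (Suc m) powr (1 + \<beta>) - real m powr (1 + \<beta>)
      = (real (Suc m) - real m) * ((1 + \<beta>) * z powr \<beta>)"
    using False by (intro MVT2) (auto intro!: derivative_eq_intros)
  then obtain z where z: "real m < z" "z < real (Suc m)"
    "real (Suc m) powr (1 + \<beta>) - real m powr (1 + \<beta>) = (1 + \<beta>) * z powr \<beta>"
    by auto
  have "z powr \<beta> \<le> real (Suc m) powr \<beta>"
    using z False assms by (intro powr_mono2) auto
  then show ?thesis using z(3) assms by simp
qed

lemma air_time_0 [simp]: "air_time \<beta> 0 = 0"
  by (simp add: air_time_def)

lemma air_time_Suc: "air_time \<beta> (Suc m) = air_time \<beta> m + air_lag \<beta> (Suc m)"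
  by (simp add: air_time_def)

lemma air_lag_pos: "1 \<le> j \<Longrightarrow> 0 < air_lag \<beta> j"
  by (simp add: air_lag_def)

lemma strict_mono_air_time: "strict_mono (air_time \<beta>)"
  by (simp add: strict_mono_Suc_iff air_time_Suc air_lag_pos)

lemma air_time_lower_bound:
  assumes "0 < \<beta>" shows "real m powr (1 + \<beta>) / (1 + \<beta>) \<le> real (air_time \<beta> m)"
proof -
  have "real m powr (1 + \<beta>) \<le> (1 + \<beta>) * real (air_time \<beta> m)"
  proof (induction m)
    case (Suc m)
    have "real (Suc m) powr \<beta> \<le> real (air_lag \<beta> (Suc m))"
      unfolding air_lag_def by linarith
    then have "(1 + \<beta>) * real (Suc m) powr \<beta> \<le> (1 + \<beta>) * real (air_lag \<beta> (Suc m))"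
      using assms by (intro mult_left_mono) auto
    then show ?case
      using powr_Suc_le[OF assms, of m] Suc by (simp add: air_time_Suc distrib_left)
  qed simp
  then show ?thesis using assms by (simp add: pos_divide_le_eq mult.commute)
qed

text \<open>The m-th adaptation time is at least of order m^(1+\<beta>), so the series is dominated
  by that of m^(-s (1+\<beta>)). Time 0 contributes nothing because \<open>0 powr - s\<close> is
  0.\<close>

lemma summable_air_times:
  assumes \<beta>: "0 < \<beta>" and s: "1 < s * (1 + \<beta>)"
  shows "summable (\<lambda>j. indicator (range (air_time \<beta>)) j * real j powr - s)"
proof -
  have s0: "0 < s" using \<beta> s zero_less_mult_pos2[of s "1 + \<beta>"] by simp
  have "summable (\<lambda>m. (1 + \<beta>) powr s * real m powr - (s * (1 + \<beta>)))"
    using s by (intro summable_mult) (simp add: summable_real_powr_iff)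
  then have "summable (\<lambda>m. real (air_time \<beta> m) powr - s)"
  proof (rule summable_comparison_test'[where N=1])
    fix m :: nat assume m: "1 \<le> m"
    then have "(real m powr (1 + \<beta>) / (1 + \<beta>)) powr s \<le> real (air_time \<beta> m) powr s"
      using \<beta> s0 by (intro powr_mono2 air_time_lower_bound) auto
    then have "inverse (real (air_time \<beta> m) powr s) \<le> inverse ((real m powr (1 + \<beta>) / (1 + \<beta>)) powr s)"
      using m \<beta> by (intro le_imp_inverse_le) auto
    also have "(real m powr (1 + \<beta>) / (1 + \<beta>)) powr s = real m powr (s * (1 + \<beta>)) / (1 + \<beta>) powr s"
      using \<beta> by (simp add: powr_divide powr_powr mult.commute)
    also have "inverse \<dots> = (1 + \<beta>) powr s * real m powr - (s * (1 + \<beta>))"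
      unfolding powr_minus by (simp add: divide_inverse)
    finally show "norm (real (air_time \<beta> m) powr - s) \<le> (1 + \<beta>) powr s * real m powr - (s * (1 + \<beta>))"
      by (simp add: powr_minus)
  qed
  then have "summable (\<lambda>m. (\<lambda>j. indicator (range (air_time \<beta>)) j * real j powr - s) (air_time \<beta> m))"
    by simp
  then show ?thesis
    by (subst (asm) summable_mono_reindex[OF strict_mono_air_time]) auto
qed

text \<open>As a horizon for \<open>poisson_avg\<close> it is constant between adaptation times, so that sums telescope
  there, and exceeds \<open>j\<close>, so that the error \<open>W / N\<close> is summable against \<open>j^(-s)\<close>.\<close>

definition next_air_time :: "real \<Rightarrow> nat \<Rightarrow> nat" where
  "next_air_time \<beta> j = (LEAST t. t \<in> range (air_time \<beta>) \<and> j < t)"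

lemma next_air_time_gt: "j < next_air_time \<beta> j"
proof -
  have "j < air_time \<beta> (Suc j)"
    using strict_mono_imp_increasing[OF strict_mono_air_time, of "Suc j" \<beta>] by simp
  then show ?thesis
    unfolding next_air_time_def by (rule_tac LeastI2[where a="air_time \<beta> (Suc j)"]) auto
qed

text \<open>A time above j is either \<open>Suc j\<close>, excluded here, or lies above
  \<open>Suc j\<close>; so both minima run over the same set.\<close>

lemma next_air_time_Suc: "Suc j \<notin> range (air_time \<beta>) \<Longrightarrow> next_air_time \<beta> (Suc j) = next_air_time \<beta> j"
  unfolding next_air_time_def by (metis Suc_lessD Suc_lessI)

lemma same_block:
  assumes "Suc j \<notin> range (air_time \<beta>)"
  obtains m where "j \<in> {air_time \<beta> m..<air_time \<beta> (Suc m)}" "Suc j \<in> {air_time \<beta> m..<air_time \<beta> (Suc m)}"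
proof -
  have "\<exists>m. air_time \<beta> m \<le> j \<and> j < air_time \<beta> (Suc m)"
  proof (rule ccontr)
    assume no: "\<not> ?thesis"
    \<comment> \<open>If no block contained j, induction would put every adaptation time at or below
      j, although they are unbounded.\<close>
    have "air_time \<beta> m \<le> j" for m
      by (induction m) (use no in \<open>auto simp: not_less\<close>)
    moreover have "j < air_time \<beta> (Suc j)"
      using strict_mono_imp_increasing[OF strict_mono_air_time, of "Suc j" \<beta>] by simp
    ultimately show False by (meson leD)
  qed
  then obtain m where m: "air_time \<beta> m \<le> j" "j < air_time \<beta> (Suc m)" by auto
  moreover have "Suc j \<noteq> air_time \<beta> (Suc m)" using assms by (metis rangeI)
  ultimately show thesis using that[of m] by auto
qed

section \<open>The strong law for the chain\<close>

text \<open>By Tonelli the weighted series has finite expectation; no information about the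
  dependence between the terms enters.\<close>

lemma AE_summable_of_bounded_expectation:
  fixes X :: "nat \<Rightarrow> 'a \<Rightarrow> real" and w :: "nat \<Rightarrow> real"
  assumes [measurable]: "\<And>n. X n \<in> borel_measurable M"
    and X: "\<And>n \<omega>. 0 \<le> X n \<omega>" and E: "\<And>n. (\<integral>\<^sup>+\<omega>. ennreal (X n \<omega>) \<partial>M) \<le> ennreal B"
    and w: "\<And>n. 0 \<le> w n" "summable w" and B: "0 \<le> B"
  shows "AE \<omega> in M. summable (\<lambda>n. w n * X n \<omega>)"
proof -
  have "(\<integral>\<^sup>+\<omega>. (\<Sum>n. ennreal (w n * X n \<omega>)) \<partial>M) = (\<Sum>n. ennreal (w n) * (\<integral>\<^sup>+\<omega>. ennreal (X n \<omega>) \<partial>M))"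
    by (subst nn_integral_suminf, measurable) (simp add: ennreal_mult w X nn_integral_cmult)
  also have "\<dots> \<le> (\<Sum>n. ennreal (w n) * ennreal B)"
    by (intro suminf_le mult_left_mono E) auto
  also have "\<dots> = (\<Sum>n. ennreal (w n * B))"
    using w B by (simp add: ennreal_mult)
  also have "\<dots> < \<infinity>"
    using w B summable_mult2[OF w(2), of B] by (simp add: suminf_ennreal2)
  finally have "AE \<omega> in M. (\<Sum>n. ennreal (w n * X n \<omega>)) \<noteq> \<infinity>"
    by (intro nn_integral_PInf_AE) auto
  then show ?thesis
    by eventually_elim (use w X in \<open>auto intro!: summable_suminf_not_top\<close>)
qed

section \<open>Drift along the chain and its martingale increments\<close>

text \<open>Normal form of the hypotheses: b is nonnegative and the minorizing measure lives on the
  whole space; in the theorem it arises as the image of a measure on \<open>C\<close> under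
  inclusion. It may depend on \<gamma> in an arbitrary way and stays under the existential
  quantifier.\<close>

locale drifting_air_mcmc = air_mcmc \<nu> MI \<pi> P \<beta> M Y \<Gamma>
  for \<nu> :: "'x::polish_space measure"
    and MI :: "'i measure"
    and \<pi> :: "'i \<Rightarrow> ('x \<times> 'f::polish_space) measure"
    and P :: "'i \<Rightarrow> 'x \<times> 'f \<Rightarrow> ('x \<times> 'f) measure"
    and \<beta> :: real
    and M :: "'w measure"
    and Y :: "nat \<Rightarrow> 'w \<Rightarrow> 'x \<times> 'f"
    and \<Gamma> :: "nat \<Rightarrow> 'w \<Rightarrow> 'i" +
  fixes C :: "('x \<times> 'f) set" and V :: "'x \<times> 'f \<Rightarrow> real" and \<kappa> b \<delta> :: real
  assumes C_sets: "C \<in> sets borel"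
    and V_measurable [measurable]: "V \<in> borel_measurable borel"
    and V_ge_1: "\<And>y. 1 \<le> V y"
    and \<kappa>: "0 < \<kappa>" "\<kappa> < 1"
    and b: "0 \<le> b"
    and \<delta>: "0 < \<delta>"
    and drift_V: "\<And>\<gamma> y. \<gamma> \<in> space MI \<Longrightarrow>
      (\<integral>\<^sup>+ y'. ennreal (V y') \<partial>P \<gamma> y) \<le> ennreal (\<kappa> * V y + b * indicator C y)"
    and minorization: "\<And>\<gamma>. \<gamma> \<in> space MI \<Longrightarrow>
      \<exists>\<eta>. prob_space \<eta> \<and> sets \<eta> = sets borel \<and>
        (\<forall>y\<in>C. \<forall>A\<in>sets borel. ennreal \<delta> * emeasure \<eta> A \<le> emeasure (P \<gamma> y) A)"
begin

definition W :: "'x \<times> 'f \<Rightarrow> real" where "W y = sqrt (V y)"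

lemma W_measurable [measurable]: "W \<in> borel_measurable borel"
  unfolding W_def by measurable

lemma W_ge_1: "1 \<le> W y"
  using V_ge_1 by (simp add: W_def)

lemma W_square: "(W y)\<^sup>2 = V y"
  using V_ge_1[of y] by (simp add: W_def)

lemma W_le_V: "W y \<le> V y"
  using W_ge_1[of y] W_square[of y] mult_left_mono[of 1 "W y" "W y"] by (simp add: power2_eq_square)

lemma measurable_P: "\<gamma> \<in> space MI \<Longrightarrow> u \<in> borel_measurable borel \<Longrightarrow> u \<in> borel_measurable (P \<gamma> y)"
  using sets_P by (simp cong: measurable_cong_sets)

lemma V_nonneg: "0 \<le> V y" and W_nonneg: "0 \<le> W y"
  using V_ge_1[of y] W_ge_1[of y] by auto

lemma integrable_V:
  assumes \<gamma>: "\<gamma> \<in> space MI" shows "integrable (P \<gamma> y) V"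
proof (rule integrableI_nonneg)
  show "(\<integral>\<^sup>+ y'. ennreal (V y') \<partial>P \<gamma> y) < \<infinity>"
    using drift_V[OF \<gamma>] by (rule order.strict_trans1) simp
  show "V \<in> borel_measurable (P \<gamma> y)" using V_measurable by (rule measurable_P[OF \<gamma>])
qed (simp add: V_nonneg)

lemma drift_W:
  assumes \<gamma>: "\<gamma> \<in> space MI"
  shows "(\<integral>\<^sup>+ y'. ennreal (W y') \<partial>P \<gamma> y) \<le> ennreal (sqrt \<kappa> * W y + sqrt b * indicator C y)"
proof -
  interpret P: prob_space "P \<gamma> y" by (rule prob_space_P[OF \<gamma>])
  note W0 = W_nonneg V_nonneg
  have int: "integrable (P \<gamma> y) W"
    using W0 W_le_V by (intro Bochner_Integration.integrable_bound[OF integrable_V[OF \<gamma>]])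
      (auto intro!: measurable_P[OF \<gamma>])
  have V: "P.expectation V \<le> \<kappa> * V y + b * indicator C y"
  proof -
    have "ennreal (P.expectation V) \<le> ennreal (\<kappa> * V y + b * indicator C y)"
      using drift_V[OF \<gamma>, of y] W0 by (subst nn_integral_eq_integral[symmetric]) (auto intro: integrable_V[OF \<gamma>])
    then show ?thesis using W0 \<kappa> b by (subst (asm) ennreal_le_iff) auto
  qed
  \<comment> \<open>Jensen's inequality for the square, in the form that the variance is
    nonnegative.\<close>
  have "(P.expectation W)\<^sup>2 \<le> P.expectation V"
    using P.variance_positive[of W] P.variance_eq[OF int] integrable_V[OF \<gamma>] by (simp add: W_square)
  then have "P.expectation W \<le> sqrt (P.expectation V)"
    by (rule real_le_rsqrt)
  also have "\<dots> \<le> sqrt (\<kappa> * V y + b * indicator C y)"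
    using V by simp
  also have "\<dots> \<le> sqrt (\<kappa> * V y) + sqrt (b * indicator C y)"
    using \<kappa> b W0 by (intro sqrt_add_le_add_sqrt) auto
  also have "\<dots> = sqrt \<kappa> * W y + sqrt b * indicator C y"
    by (auto simp: W_def real_sqrt_mult indicator_def)
  finally show ?thesis
    using W0 int by (subst nn_integral_eq_integral) (auto intro: ennreal_leI)
qed

text \<open>The numerical constants of this instance are the same for all \<gamma>; only the kernel,
  \<eta> and the invariant distribution vary. The uniform bounds below rest on this.\<close>

lemma fibre_drift_minorization:
  assumes \<gamma>: "\<gamma> \<in> space MI"
  obtains \<eta> where "stationary_drift_minorization borel (P \<gamma>) W C (sqrt \<kappa>) (sqrt b) \<delta> \<eta> (\<pi> \<gamma>)"
proof -
  obtain \<eta> where \<eta>: "prob_space \<eta>" "sets \<eta> = sets borel"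
    "\<And>y A. y \<in> C \<Longrightarrow> A \<in> sets borel \<Longrightarrow> ennreal \<delta> * emeasure \<eta> A \<le> emeasure (P \<gamma> y) A"
    using minorization[OF \<gamma>] by blast
  have "stationary_drift_minorization borel (P \<gamma>) W C (sqrt \<kappa>) (sqrt b) \<delta> \<eta> (\<pi> \<gamma>)"
    by (intro stationary_drift_minorization.intro drift_minorization.intro stationary_drift_minorization_axioms.intro)
      (rule kernel[OF \<gamma>] W_measurable W_ge_1 C_sets \<delta> drift_W[OF \<gamma>] \<eta> invariant[OF \<gamma>]
        | assumption | simp add: \<kappa> b less_imp_le)+
  then show thesis by (rule that)
qed

lemma kernel_op_W_le:
  assumes \<gamma>: "\<gamma> \<in> space MI" shows "kernel_op (P \<gamma>) W y \<le> (1 + sqrt b) * W y"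
proof -
  obtain \<eta> where "stationary_drift_minorization borel (P \<gamma>) W C (sqrt \<kappa>) (sqrt b) \<delta> \<eta> (\<pi> \<gamma>)"
    using fibre_drift_minorization[OF \<gamma>] .
  then interpret stationary_drift_minorization borel "P \<gamma>" W C "sqrt \<kappa>" "sqrt b" \<delta> \<eta> "\<pi> \<gamma>" .
  have "kernel_op (P \<gamma>) W y \<le> sqrt \<kappa> * W y + sqrt b * indicator C y"
    by (rule kernel_op_W_le) simp
  also have "\<dots> \<le> 1 * W y + sqrt b * W y"
  proof (rule add_mono)
    show "sqrt \<kappa> * W y \<le> 1 * W y" using \<kappa> W_nonneg[of y] by (intro mult_right_mono) auto
    show "sqrt b * indicator C y \<le> sqrt b * W y"
      using b W_ge_1[of y] by (intro mult_left_mono) (simp_all add: indicator_def)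
  qed
  finally show ?thesis by (simp add: distrib_right)
qed

lemma integrable_P:
  assumes \<gamma>: "\<gamma> \<in> space MI" and u: "u \<in> borel_measurable borel" "\<And>y. \<bar>u y\<bar> \<le> c * W y"
  shows "integrable (P \<gamma> y) u"
proof -
  obtain \<eta> where "stationary_drift_minorization borel (P \<gamma>) W C (sqrt \<kappa>) (sqrt b) \<delta> \<eta> (\<pi> \<gamma>)"
    using fibre_drift_minorization[OF \<gamma>] .
  then interpret stationary_drift_minorization borel "P \<gamma>" W C "sqrt \<kappa>" "sqrt b" \<delta> \<eta> "\<pi> \<gamma>" .
  have "integrable (P \<gamma> y) (\<lambda>y. c * W y)"
    using integrable_W[of y] by simp
  then show ?thesis
  proof (rule Bochner_Integration.integrable_bound)
    show "u \<in> borel_measurable (P \<gamma> y)" using u(1) by (rule measurable_P[OF \<gamma>])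
    show "AE z in P \<gamma> y. norm (u z) \<le> norm (c * W z)"
      unfolding real_norm_def using order_trans[OF u(2) abs_ge_self] by (intro AE_I2)
  qed
qed

lemma integrable_\<pi>:
  assumes \<gamma>: "\<gamma> \<in> space MI" and u: "u \<in> borel_measurable borel" "\<And>y. \<bar>u y\<bar> \<le> W y"
  shows "integrable (\<pi> \<gamma>) u"
proof -
  obtain \<eta> where "stationary_drift_minorization borel (P \<gamma>) W C (sqrt \<kappa>) (sqrt b) \<delta> \<eta> (\<pi> \<gamma>)"
    using fibre_drift_minorization[OF \<gamma>] .
  then interpret stationary_drift_minorization borel "P \<gamma>" W C "sqrt \<kappa>" "sqrt b" \<delta> \<eta> "\<pi> \<gamma>" .
  show ?thesis
  proof (rule integrable_\<mu>[of 1], unfold dominated_def, intro conjI ballI u(1))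
    fix y
    have "0 \<le> sqrt b / \<delta>" using b \<delta> by (intro divide_nonneg_pos) auto
    then have "W y \<le> 1 * U y" unfolding U_def by simp
    then show "\<bar>u y\<bar> \<le> 1 * U y" by (rule order_trans[OF u(2)])
  qed
qed

lemma V_bounded_expectation:
  "\<exists>B\<ge>0. \<forall>n. (\<integral>\<^sup>+\<omega>. ennreal (V (Y n \<omega>)) \<partial>M) \<le> ennreal B"
proof -
  obtain y0 \<gamma>0 where "\<forall>\<omega>\<in>space M. Y 0 \<omega> = y0 \<and> \<Gamma> 0 \<omega> = \<gamma>0"
    using start by (elim exE)
  then have y0: "Y 0 \<omega> = y0" if "\<omega> \<in> space M" for \<omega>
    using that by simp
  \<comment> \<open>Chosen to dominate the deterministic initial value \<open>V y0\<close> and to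
    satisfy \<kappa> B + b \<le> B, so that the bound reproduces itself under the drift.\<close>
  define B where "B = V y0 + b / (1 - \<kappa>)"
  note V0 = V_nonneg
  have B: "0 \<le> B" using V0 b \<kappa> by (simp add: B_def)
  have step: "\<kappa> * B + b \<le> B"
  proof -
    have "(1 - \<kappa>) * B = (1 - \<kappa>) * V y0 + b" using \<kappa> by (simp add: B_def distrib_left)
    moreover have "0 \<le> (1 - \<kappa>) * V y0" using \<kappa> V0 by simp
    ultimately show ?thesis by (simp add: left_diff_distrib)
  qed
  have "(\<integral>\<^sup>+\<omega>. ennreal (V (Y n \<omega>)) \<partial>M) \<le> ennreal B" for n
  proof (induction n)
    case 0
    have "(\<integral>\<^sup>+\<omega>. ennreal (V (Y 0 \<omega>)) \<partial>M) = (\<integral>\<^sup>+\<omega>. ennreal (V y0) \<partial>M)"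
      by (intro nn_integral_cong) (simp add: y0)
    then show ?case
      using b \<kappa> by (auto simp: emeasure_space_1 B_def intro!: ennreal_leI)
  next
    case (Suc n)
    have "(\<lambda>z. ennreal (V (snd z))) \<in> borel_measurable (H n \<Otimes>\<^sub>M borel)" by measurable
    from disintegration[OF this]
    have "(\<integral>\<^sup>+\<omega>. ennreal (V (Y (Suc n) \<omega>)) \<partial>M) = (\<integral>\<^sup>+\<omega>. (\<integral>\<^sup>+y. ennreal (V y) \<partial>Ker n \<omega>) \<partial>M)" by simp
    also have "\<dots> \<le> (\<integral>\<^sup>+\<omega>. ennreal \<kappa> * ennreal (V (Y n \<omega>)) + ennreal b \<partial>M)"
    proof (intro nn_integral_mono)
      fix \<omega> assume "\<omega> \<in> space M"
      then have "(\<integral>\<^sup>+y. ennreal (V y) \<partial>Ker n \<omega>) \<le> ennreal (\<kappa> * V (Y n \<omega>) + b * indicator C (Y n \<omega>))"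
        by (intro drift_V \<Gamma>_space)
      also have "\<dots> \<le> ennreal (\<kappa> * V (Y n \<omega>) + b)"
        using b by (intro ennreal_leI) (auto simp: indicator_def)
      finally show "(\<integral>\<^sup>+y. ennreal (V y) \<partial>Ker n \<omega>) \<le> ennreal \<kappa> * ennreal (V (Y n \<omega>)) + ennreal b"
        using \<kappa> b V0 by (simp add: ennreal_mult)
    qed
    also have "\<dots> = ennreal \<kappa> * (\<integral>\<^sup>+\<omega>. ennreal (V (Y n \<omega>)) \<partial>M) + ennreal b"
      using measurable_compose[OF Y_measurable[of n] V_measurable]
      by (simp add: nn_integral_add nn_integral_cmult emeasure_space_1)
    also have "\<dots> \<le> ennreal \<kappa> * ennreal B + ennreal b"
      by (intro add_mono mult_left_mono Suc) auto
    also have "\<dots> = ennreal (\<kappa> * B + b)"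
      using \<kappa> B b by (simp add: ennreal_mult)
    also have "\<dots> \<le> ennreal B" using step by (rule ennreal_leI)
    finally show ?case .
  qed
  with B show ?thesis by blast
qed

lemma integrable_V_Y: "integrable M (\<lambda>\<omega>. V (Y n \<omega>))"
proof -
  obtain B where "0 \<le> B" and B: "\<And>n. (\<integral>\<^sup>+\<omega>. ennreal (V (Y n \<omega>)) \<partial>M) \<le> ennreal B"
    using V_bounded_expectation by blast
  show ?thesis
  proof (rule integrableI_nonneg)
    show "(\<integral>\<^sup>+\<omega>. ennreal (V (Y n \<omega>)) \<partial>M) < \<infinity>"
      using B by (rule order.strict_trans1) simp
  qed (use V_nonneg measurable_compose[OF Y_measurable[of n] V_measurable] in auto)
qed

lemma integrable_W_Y: "integrable M (\<lambda>\<omega>. W (Y n \<omega>))"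
proof (rule Bochner_Integration.integrable_bound[OF integrable_V_Y[of n]])
  show "AE \<omega> in M. norm (W (Y n \<omega>)) \<le> norm (V (Y n \<omega>))"
    using W_le_V V_nonneg W_nonneg by simp
qed (rule measurable_compose[OF Y_measurable W_measurable])

lemma section_measurable:
  assumes F: "(\<lambda>(y, \<gamma>). F \<gamma> y) \<in> borel_measurable (borel \<Otimes>\<^sub>M MI)" and \<gamma>: "\<gamma> \<in> space MI"
  shows "F \<gamma> \<in> borel_measurable borel"
  using measurable_compose[OF measurable_Pair2'[OF \<gamma>] F] by simp

lemma measurable_H: "u \<in> borel_measurable (H n) \<Longrightarrow> u \<in> borel_measurable M"
  by (rule measurable_from_subalg[OF subalgebra_history])

context
  fixes F :: "'i \<Rightarrow> 'x \<times> 'f \<Rightarrow> real" and c :: real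
  assumes F_measurable: "(\<lambda>(y, \<gamma>). F \<gamma> y) \<in> borel_measurable (borel \<Otimes>\<^sub>M MI)"
    and F_bound: "\<And>\<gamma> y. \<gamma> \<in> space MI \<Longrightarrow> \<bar>F \<gamma> y\<bar> \<le> c * W y"
begin

lemma innovation_measurable:
  "(\<lambda>\<omega>. F (\<Gamma> n \<omega>) (Y (Suc n) \<omega>)) \<in> borel_measurable (H (Suc n))"
  "(\<lambda>\<omega>. kernel_op (P (\<Gamma> n \<omega>)) (F (\<Gamma> n \<omega>)) (Y n \<omega>)) \<in> borel_measurable (H n)"
proof -
  have "(\<lambda>\<omega>. (Y (Suc n) \<omega>, \<Gamma> n \<omega>)) \<in> H (Suc n) \<rightarrow>\<^sub>M borel \<Otimes>\<^sub>M MI"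
    by (intro measurable_Pair Y_adapted \<Gamma>_adapted) auto
  from measurable_compose[OF this F_measurable]
  show "(\<lambda>\<omega>. F (\<Gamma> n \<omega>) (Y (Suc n) \<omega>)) \<in> borel_measurable (H (Suc n))" by simp
  have "(\<lambda>\<omega>. (Y n \<omega>, \<Gamma> n \<omega>)) \<in> H n \<rightarrow>\<^sub>M borel \<Otimes>\<^sub>M MI"
    by (intro measurable_Pair Y_adapted \<Gamma>_adapted) auto
  from measurable_compose[OF this kernel_op_jointly_measurable[OF F_measurable]]
  show "(\<lambda>\<omega>. kernel_op (P (\<Gamma> n \<omega>)) (F (\<Gamma> n \<omega>)) (Y n \<omega>)) \<in> borel_measurable (H n)" by simp
qed

lemma kernel_op_F_bound:
  assumes \<gamma>: "\<gamma> \<in> space MI" shows "\<bar>kernel_op (P \<gamma>) (F \<gamma>) y\<bar> \<le> c * (1 + sqrt b) * W y"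
proof -
  note int = integrable_P[OF \<gamma> section_measurable[OF F_measurable \<gamma>] F_bound[OF \<gamma>], of y]
  have c: "0 \<le> c" using F_bound[OF \<gamma>, of y] W_ge_1[of y] by (smt (verit) mult_neg_pos)
  have "\<bar>kernel_op (P \<gamma>) (F \<gamma>) y\<bar> \<le> (\<integral>z. \<bar>F \<gamma> z\<bar> \<partial>P \<gamma> y)"
    unfolding kernel_op_def by (rule integral_abs_bound)
  also have "\<dots> \<le> (\<integral>z. c * W z \<partial>P \<gamma> y)"
    using int F_bound[OF \<gamma>] integrable_P[OF \<gamma> W_measurable, of 1 y] W_nonneg by (intro integral_mono) auto
  also have "\<dots> = c * kernel_op (P \<gamma>) W y" by (simp add: kernel_op_def)
  also have "\<dots> \<le> c * ((1 + sqrt b) * W y)"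
    using c kernel_op_W_le[OF \<gamma>] by (rule mult_left_mono[rotated])
  finally show ?thesis by (simp add: mult.assoc)
qed

lemma innovation_integrable:
  "integrable M (\<lambda>\<omega>. F (\<Gamma> n \<omega>) (Y (Suc n) \<omega>))"
  "integrable M (\<lambda>\<omega>. kernel_op (P (\<Gamma> n \<omega>)) (F (\<Gamma> n \<omega>)) (Y n \<omega>))"
proof -
  show "integrable M (\<lambda>\<omega>. F (\<Gamma> n \<omega>) (Y (Suc n) \<omega>))"
  proof (rule Bochner_Integration.integrable_bound)
    show "integrable M (\<lambda>\<omega>. c * W (Y (Suc n) \<omega>))" using integrable_W_Y by simp
    show "AE \<omega> in M. norm (F (\<Gamma> n \<omega>) (Y (Suc n) \<omega>)) \<le> norm (c * W (Y (Suc n) \<omega>))"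
      unfolding real_norm_def by (intro AE_I2 order_trans[OF F_bound abs_ge_self] \<Gamma>_space)
  qed (rule measurable_H[OF innovation_measurable(1)])
  show "integrable M (\<lambda>\<omega>. kernel_op (P (\<Gamma> n \<omega>)) (F (\<Gamma> n \<omega>)) (Y n \<omega>))"
  proof (rule Bochner_Integration.integrable_bound)
    show "integrable M (\<lambda>\<omega>. c * (1 + sqrt b) * W (Y n \<omega>))" using integrable_W_Y by simp
    show "AE \<omega> in M. norm (kernel_op (P (\<Gamma> n \<omega>)) (F (\<Gamma> n \<omega>)) (Y n \<omega>)) \<le> norm (c * (1 + sqrt b) * W (Y n \<omega>))"
      unfolding real_norm_def by (intro AE_I2 order_trans[OF kernel_op_F_bound abs_ge_self] \<Gamma>_space)
  qed (rule measurable_H[OF innovation_measurable(2)])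
qed

text \<open>Nonnegativity is assumed because \<open>disintegration\<close> concerns nonnegative
  integrals. Functions of either sign are reached later by adding a multiple of
  \<open>W\<close>.\<close>

lemma innovation_nonneg:
  assumes nonneg: "\<And>\<gamma> y. \<gamma> \<in> space MI \<Longrightarrow> 0 \<le> F \<gamma> y" and A: "A \<in> sets (H n)"
  shows "(\<integral>\<omega>. indicator A \<omega> * F (\<Gamma> n \<omega>) (Y (Suc n) \<omega>) \<partial>M)
    = (\<integral>\<omega>. indicator A \<omega> * kernel_op (P (\<Gamma> n \<omega>)) (F (\<Gamma> n \<omega>)) (Y n \<omega>) \<partial>M)"
proof -
  have K_nonneg: "0 \<le> kernel_op (P \<gamma>) (F \<gamma>) y" if "\<gamma> \<in> space MI" for \<gamma> y
    unfolding kernel_op_def using nonneg[OF that] by simp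
  have IA: "(indicator A :: 'w \<Rightarrow> real) \<in> borel_measurable (H n)" using A by simp
  have mH: "(\<lambda>(\<omega>, y). ennreal (indicator A \<omega> * F (\<Gamma> n \<omega>) y)) \<in> borel_measurable (H n \<Otimes>\<^sub>M borel)"
  proof -
    have "(\<lambda>x. (snd x, \<Gamma> n (fst x))) \<in> H n \<Otimes>\<^sub>M borel \<rightarrow>\<^sub>M borel \<Otimes>\<^sub>M MI"
      by (intro measurable_Pair measurable_snd measurable_compose[OF measurable_fst \<Gamma>_adapted]) auto
    from measurable_compose[OF this F_measurable]
    have "(\<lambda>x. F (\<Gamma> n (fst x)) (snd x)) \<in> borel_measurable (H n \<Otimes>\<^sub>M borel)" by simp
    then show ?thesis
      using measurable_compose[OF measurable_fst IA]
      by (auto simp: split_beta' intro!: measurable_compose[OF _ measurable_ennreal] borel_measurable_times)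
  qed
  have mA: "(\<lambda>\<omega>. indicator A \<omega> :: real) \<in> borel_measurable M"
    by (rule measurable_H[OF IA])
  have "(\<integral>\<omega>. indicator A \<omega> * F (\<Gamma> n \<omega>) (Y (Suc n) \<omega>) \<partial>M)
      = enn2real (\<integral>\<^sup>+\<omega>. ennreal (indicator A \<omega> * F (\<Gamma> n \<omega>) (Y (Suc n) \<omega>)) \<partial>M)"
    using nonneg \<Gamma>_space by (intro integral_eq_nn_integral AE_I2 borel_measurable_times mA measurable_H[OF innovation_measurable(1)]) simp
  also have "(\<integral>\<^sup>+\<omega>. ennreal (indicator A \<omega> * F (\<Gamma> n \<omega>) (Y (Suc n) \<omega>)) \<partial>M)
      = (\<integral>\<^sup>+\<omega>. (\<integral>\<^sup>+y. ennreal (indicator A \<omega> * F (\<Gamma> n \<omega>) y) \<partial>Ker n \<omega>) \<partial>M)"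
    using disintegration[OF mH] by simp
  also have "\<dots> = (\<integral>\<^sup>+\<omega>. ennreal (indicator A \<omega> * kernel_op (P (\<Gamma> n \<omega>)) (F (\<Gamma> n \<omega>)) (Y n \<omega>)) \<partial>M)"
  proof (rule nn_integral_cong)
    fix \<omega> assume "\<omega> \<in> space M"
    then have \<gamma>: "\<Gamma> n \<omega> \<in> space MI" by (rule \<Gamma>_space)
    have "(\<integral>\<^sup>+y. ennreal (indicator A \<omega> * F (\<Gamma> n \<omega>) y) \<partial>Ker n \<omega>) = ennreal (\<integral>y. indicator A \<omega> * F (\<Gamma> n \<omega>) y \<partial>Ker n \<omega>)"
      using nonneg[OF \<gamma>] integrable_P[OF \<gamma> section_measurable[OF F_measurable \<gamma>] F_bound[OF \<gamma>]]
      by (intro nn_integral_eq_integral) auto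
    then show "(\<integral>\<^sup>+y. ennreal (indicator A \<omega> * F (\<Gamma> n \<omega>) y) \<partial>Ker n \<omega>)
        = ennreal (indicator A \<omega> * kernel_op (P (\<Gamma> n \<omega>)) (F (\<Gamma> n \<omega>)) (Y n \<omega>))"
      by (simp add: kernel_op_def)
  qed
  also have "enn2real \<dots> = (\<integral>\<omega>. indicator A \<omega> * kernel_op (P (\<Gamma> n \<omega>)) (F (\<Gamma> n \<omega>)) (Y n \<omega>) \<partial>M)"
    using K_nonneg \<Gamma>_space by (intro integral_eq_nn_integral[symmetric] AE_I2 borel_measurable_times mA measurable_H[OF innovation_measurable(2)]) simp
  finally show ?thesis .
qed

end

text \<open>The parameter \<open>\<Gamma> n\<close> and the index n are kept in the first term
  although the state is already \<open>Y (Suc n)\<close>: with the new parameter the increment need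
  not be centred. Replacing them is charged to the jump terms of the decomposition.\<close>

definition innovation :: "(nat \<Rightarrow> 'i \<Rightarrow> 'x \<times> 'f \<Rightarrow> real) \<Rightarrow> nat \<Rightarrow> 'w \<Rightarrow> real" where
  "innovation F n \<omega> = F n (\<Gamma> n \<omega>) (Y (Suc n) \<omega>) - kernel_op (P (\<Gamma> n \<omega>)) (F n (\<Gamma> n \<omega>)) (Y n \<omega>)"

lemma innovation_strong_law:
  assumes F: "\<And>n. (\<lambda>(y, \<gamma>). F n \<gamma> y) \<in> borel_measurable (borel \<Otimes>\<^sub>M MI)"
    and F_bound: "\<And>n \<gamma> y. \<gamma> \<in> space MI \<Longrightarrow> \<bar>F n \<gamma> y\<bar> \<le> c * W y"
    and s: "s > 1 / 2"
  shows "AE \<omega> in M. (\<lambda>n. (\<Sum>k<n. innovation F k \<omega>) / real n powr s) \<longlonglongrightarrow> 0"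
proof -
  note meas = innovation_measurable[OF F F_bound] and int = innovation_integrable[OF F F_bound]
  obtain \<omega>0 where \<omega>0: "\<omega>0 \<in> space M" using not_empty by auto
  have c: "0 \<le> c"
    using F_bound[OF \<Gamma>_space[OF \<omega>0, of 0], of 0 undefined] W_ge_1[of undefined] by (smt (verit) mult_neg_pos)
  \<comment> \<open>From (a + d)^2 \<le> 2 a^2 + 2 d^2 and W^2 = V, where 1 + sqrt b bounds the
    effect of the kernel on \<open>W\<close>.\<close>
  define K where "K = 2 * (c * (1 + sqrt b))\<^sup>2"
  have K: "0 \<le> K" by (simp add: K_def)
  have I_meas: "innovation F n \<in> borel_measurable (H (Suc n))" for n
    unfolding innovation_def using meas(1)[of n n] meas(2)[of n n] history_mono[of n "Suc n"]
    by (intro borel_measurable_diff) (auto simp: measurable_def)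
  have I_int: "integrable M (innovation F n)" for n
    unfolding innovation_def using int by auto
  have I_sq: "(innovation F n \<omega>)\<^sup>2 \<le> K * (V (Y (Suc n) \<omega>) + V (Y n \<omega>))" if \<omega>: "\<omega> \<in> space M" for n \<omega>
  proof -
    define a where "a = \<bar>F n (\<Gamma> n \<omega>) (Y (Suc n) \<omega>)\<bar>"
    define d where "d = \<bar>kernel_op (P (\<Gamma> n \<omega>)) (F n (\<Gamma> n \<omega>)) (Y n \<omega>)\<bar>"
    have sb: "0 \<le> sqrt b" using b by simp
    have "a \<le> c * W (Y (Suc n) \<omega>)" unfolding a_def by (rule F_bound[OF \<Gamma>_space[OF \<omega>]])
    also have "\<dots> \<le> (c * (1 + sqrt b)) * W (Y (Suc n) \<omega>)"
      using c sb W_nonneg by (intro mult_right_mono) (auto simp: distrib_left)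
    finally have "a\<^sup>2 \<le> ((c * (1 + sqrt b)) * W (Y (Suc n) \<omega>))\<^sup>2"
      by (rule power_mono) (simp add: a_def)
    then have a: "a\<^sup>2 \<le> (c * (1 + sqrt b))\<^sup>2 * V (Y (Suc n) \<omega>)"
      by (simp only: power_mult_distrib W_square)
    have "d \<le> (c * (1 + sqrt b)) * W (Y n \<omega>)"
      unfolding d_def by (rule kernel_op_F_bound[OF F F_bound \<Gamma>_space[OF \<omega>]])
    then have "d\<^sup>2 \<le> ((c * (1 + sqrt b)) * W (Y n \<omega>))\<^sup>2"
      by (rule power_mono) (simp add: d_def)
    then have d: "d\<^sup>2 \<le> (c * (1 + sqrt b))\<^sup>2 * V (Y n \<omega>)"
      by (simp only: power_mult_distrib W_square)
    have "\<bar>innovation F n \<omega>\<bar> \<le> a + d"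
      unfolding innovation_def a_def d_def by (rule abs_triangle_ineq4)
    then have "(innovation F n \<omega>)\<^sup>2 \<le> (a + d)\<^sup>2"
      using abs_le_square_iff[of "innovation F n \<omega>" "a + d"] by (simp add: a_def d_def)
    also have "\<dots> \<le> 2 * a\<^sup>2 + 2 * d\<^sup>2"
      using zero_le_power2[of "a - d"] by (simp add: power2_sum power2_diff)
    finally show ?thesis
      using a d by (simp add: K_def distrib_left)
  qed
  have I_sq_int: "integrable M (\<lambda>\<omega>. (innovation F n \<omega>)\<^sup>2)" for n
  proof (rule Bochner_Integration.integrable_bound)
    show "integrable M (\<lambda>\<omega>. K * (V (Y (Suc n) \<omega>) + V (Y n \<omega>)))"
      by (intro integrable_mult_right Bochner_Integration.integrable_add integrable_V_Y)
    show "AE \<omega> in M. norm ((innovation F n \<omega>)\<^sup>2) \<le> norm (K * (V (Y (Suc n) \<omega>) + V (Y n \<omega>)))"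
      using I_sq by (intro AE_I2) (simp add: order_trans[OF _ abs_ge_self])
    show "(\<lambda>\<omega>. (innovation F n \<omega>)\<^sup>2) \<in> borel_measurable M"
      by (intro borel_measurable_power measurable_H[OF I_meas])
  qed
  have centred: "(\<integral>\<omega>\<in>A. innovation F n \<omega> \<partial>M) = (\<integral>\<omega>\<in>A. 0 \<partial>M)" if A: "A \<in> sets (H n)" for A n
  proof -
    have AM: "A \<in> events" using A subalgebra_history by (auto simp: subalgebra_def)
    \<comment> \<open>Both F n + c W and c W are nonnegative, so \<open>innovation_nonneg\<close>
      applies to each; subtracting gives the identity for F n.\<close>
    have cW: "(\<lambda>(y, \<gamma>). c * W y) \<in> borel_measurable (borel \<Otimes>\<^sub>M MI)"
      using measurable_compose[OF measurable_fst W_measurable] by (simp add: split_beta')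
    have cW_bound: "\<bar>c * W y\<bar> \<le> c * W y" for y using c W_nonneg by simp
    have G: "(\<lambda>(y, \<gamma>). F n \<gamma> y + c * W y) \<in> borel_measurable (borel \<Otimes>\<^sub>M MI)"
      using borel_measurable_add[OF F[of n] cW] by (simp add: split_beta')
    have G_bound: "\<bar>F n \<gamma> y + c * W y\<bar> \<le> (2 * c) * W y" and G_nonneg: "0 \<le> F n \<gamma> y + c * W y" if "\<gamma> \<in> space MI" for \<gamma> y
      using F_bound[OF that, of n y] c W_nonneg[of y] by auto
    note intA = integrable_mult_indicator[OF AM, unfolded real_scaleR_def]
    have K_add: "kernel_op (P (\<Gamma> n \<omega>)) (\<lambda>y. F n (\<Gamma> n \<omega>) y + c * W y) (Y n \<omega>)
        = kernel_op (P (\<Gamma> n \<omega>)) (F n (\<Gamma> n \<omega>)) (Y n \<omega>) + kernel_op (P (\<Gamma> n \<omega>)) (\<lambda>y. c * W y) (Y n \<omega>)"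
      if "\<omega> \<in> space M" for \<omega>
      unfolding kernel_op_def
      using integrable_P[OF \<Gamma>_space[OF that] section_measurable[OF F \<Gamma>_space[OF that]] F_bound[OF \<Gamma>_space[OF that]]]
        integrable_P[OF \<Gamma>_space[OF that] section_measurable[OF cW \<Gamma>_space[OF that]] cW_bound]
      by (rule Bochner_Integration.integral_add)
    have "(\<integral>\<omega>. indicator A \<omega> * (F n (\<Gamma> n \<omega>) (Y (Suc n) \<omega>) + c * W (Y (Suc n) \<omega>)) \<partial>M)
      = (\<integral>\<omega>. indicator A \<omega> * (kernel_op (P (\<Gamma> n \<omega>)) (F n (\<Gamma> n \<omega>)) (Y n \<omega>) + kernel_op (P (\<Gamma> n \<omega>)) (\<lambda>y. c * W y) (Y n \<omega>)) \<partial>M)"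
      using innovation_nonneg[OF G G_bound G_nonneg A] K_add by (simp cong: Bochner_Integration.integral_cong)
    moreover have "(\<integral>\<omega>. indicator A \<omega> * (c * W (Y (Suc n) \<omega>)) \<partial>M)
      = (\<integral>\<omega>. indicator A \<omega> * kernel_op (P (\<Gamma> n \<omega>)) (\<lambda>y. c * W y) (Y n \<omega>) \<partial>M)"
      using cW_bound c W_nonneg by (intro innovation_nonneg[OF cW _ _ A]) auto
    ultimately have "(\<integral>\<omega>. indicator A \<omega> * F n (\<Gamma> n \<omega>) (Y (Suc n) \<omega>) \<partial>M)
      = (\<integral>\<omega>. indicator A \<omega> * kernel_op (P (\<Gamma> n \<omega>)) (F n (\<Gamma> n \<omega>)) (Y n \<omega>) \<partial>M)"
      using intA[OF int(1)] intA[OF int(2)] intA[OF innovation_integrable(1)[OF cW cW_bound]]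
        intA[OF innovation_integrable(2)[OF cW cW_bound]]
      by (simp add: distrib_left)
    then show ?thesis
      unfolding set_lebesgue_integral_def innovation_def
      using intA[OF int(1)[of n n]] intA[OF int(2)[of n n]] by (simp add: right_diff_distrib)
  qed
  interpret martingale_differences M H "innovation F"
  proof
    show "subalgebra M (H n)" for n by (rule subalgebra_history)
    show "sets (H m) \<subseteq> sets (H n)" if "m \<le> n" for m n using that by (rule history_mono)
    show "AE \<omega> in M. real_cond_exp M (H n) (innovation F n) \<omega> = 0" for n
    proof -
      interpret finite_measure_subalgebra M "H n" by unfold_locales (rule subalgebra_history)
      show ?thesis using centred I_int by (intro real_cond_exp_charact) auto
    qed
  qed (use I_meas I_sq_int in auto)
  obtain B where B: "0 \<le> B" "\<And>n. (\<integral>\<^sup>+\<omega>. ennreal (V (Y n \<omega>)) \<partial>M) \<le> ennreal B"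
    using V_bounded_expectation by blast
  have EV: "(\<integral>\<omega>. V (Y n \<omega>) \<partial>M) \<le> B" for n
    using B(2)[of n] B(1) V_nonneg integrable_V_Y[of n] by (simp add: nn_integral_eq_integral)
  have "(\<integral>\<omega>. (innovation F n \<omega>)\<^sup>2 \<partial>M) \<le> K * (B + B)" for n
  proof -
    have "(\<integral>\<omega>. (innovation F n \<omega>)\<^sup>2 \<partial>M) \<le> (\<integral>\<omega>. K * (V (Y (Suc n) \<omega>) + V (Y n \<omega>)) \<partial>M)"
      using I_sq by (intro integral_mono I_sq_int integrable_mult_right Bochner_Integration.integrable_add integrable_V_Y) auto
    also have "\<dots> = K * ((\<integral>\<omega>. V (Y (Suc n) \<omega>) \<partial>M) + (\<integral>\<omega>. V (Y n \<omega>) \<partial>M))"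
      using integrable_V_Y by simp
    also have "\<dots> \<le> K * (B + B)" using K by (intro mult_left_mono add_mono EV)
    finally show ?thesis .
  qed
  then show ?thesis using s by (rule strong_law)
qed

end

section \<open>Remainder terms and centred sums\<close>

text \<open>A crude form of Kronecker's lemma. Since the terms are nonnegative, their sum is at most
  n^t times the full series, and the gap t < s leaves the factor n^(t - s), which tends to
  0.\<close>

lemma kronecker_nonneg:
  fixes a :: "nat \<Rightarrow> real"
  assumes a: "\<And>j. 0 \<le> a j" and t: "0 \<le> t" "t < s"
    and summable: "summable (\<lambda>j. real (Suc j) powr - t * a j)"
  shows "(\<lambda>n. (\<Sum>j<n. a j) / real n powr s) \<longlonglongrightarrow> 0"
proof -
  let ?A = "\<Sum>j. real (Suc j) powr - t * a j"
  have bound: "(\<Sum>j<n. a j) \<le> real n powr t * ?A" for n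
  proof -
    have "(\<Sum>j<n. a j) \<le> (\<Sum>j<n. real n powr t * (real (Suc j) powr - t * a j))"
    proof (rule sum_mono)
      fix j assume j: "j \<in> {..<n}"
      have "1 \<le> real n powr t * real (Suc j) powr - t"
      proof -
        have "real (Suc j) powr t \<le> real n powr t" using j t by (intro powr_mono2) auto
        then show ?thesis by (simp add: powr_minus field_simps)
      qed
      then show "a j \<le> real n powr t * (real (Suc j) powr - t * a j)"
        using mult_right_mono[OF _ a[of j]] by (fastforce simp: mult.assoc)
    qed
    also have "\<dots> = real n powr t * (\<Sum>j<n. real (Suc j) powr - t * a j)"
      by (simp add: sum_distrib_left)
    also have "\<dots> \<le> real n powr t * ?A"
      using a by (intro mult_left_mono sum_le_suminf summable) auto
    finally show ?thesis .
  qed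
  have "(\<lambda>n. ?A * real n powr (t - s)) \<longlonglongrightarrow> ?A * 0"
    using t by (intro tendsto_mult_left tendsto_neg_powr filterlim_real_sequentially) auto
  then have "(\<lambda>n. ?A * real n powr (t - s)) \<longlonglongrightarrow> 0" by simp
  then show ?thesis
  proof (rule Lim_null_comparison[rotated])
    show "\<forall>\<^sub>F n in sequentially. norm ((\<Sum>j<n. a j) / real n powr s) \<le> ?A * real n powr (t - s)"
      using eventually_gt_at_top[of 0]
    proof eventually_elim
      case (elim n)
      have "norm ((\<Sum>j<n. a j) / real n powr s) = (\<Sum>j<n. a j) / real n powr s"
        using a by (simp add: sum_nonneg)
      also have "\<dots> \<le> real n powr t * ?A / real n powr s"
        by (intro divide_right_mono bound) simp
      also have "\<dots> = ?A * real n powr (t - s)" by (simp add: powr_diff)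
      finally show ?case .
    qed
  qed
qed

context drifting_air_mcmc begin

lemma W_bounded_expectation: "\<exists>B\<ge>0. \<forall>n. (\<integral>\<^sup>+\<omega>. ennreal (W (Y n \<omega>)) \<partial>M) \<le> ennreal B"
proof -
  have "(\<integral>\<^sup>+\<omega>. ennreal (W (Y n \<omega>)) \<partial>M) \<le> (\<integral>\<^sup>+\<omega>. ennreal (V (Y n \<omega>)) \<partial>M)" for n
    by (intro nn_integral_mono ennreal_leI W_le_V)
  then show ?thesis using V_bounded_expectation by (meson order_trans)
qed

text \<open>The series of n^(-2 s) V(Y_n) has finite expectation when 2 s > 1, so almost surely its
  terms tend to 0, and so do their square roots.\<close>

lemma W_negligible:
  assumes s: "s > 1 / 2"
  shows "AE \<omega> in M. (\<lambda>n. W (Y n \<omega>) / real n powr s) \<longlonglongrightarrow> 0"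
proof -
  obtain B where "0 \<le> B" "\<And>n. (\<integral>\<^sup>+\<omega>. ennreal (V (Y n \<omega>)) \<partial>M) \<le> ennreal B"
    using V_bounded_expectation by blast
  then have "AE \<omega> in M. summable (\<lambda>n. real n powr (- (2 * s)) * V (Y n \<omega>))"
    using s V_nonneg measurable_compose[OF Y_measurable V_measurable]
    by (intro AE_summable_of_bounded_expectation) (auto simp: summable_real_powr_iff)
  then show ?thesis
  proof eventually_elim
    case (elim \<omega>)
    have "(\<lambda>n. sqrt (real n powr (- (2 * s)) * V (Y n \<omega>))) \<longlonglongrightarrow> sqrt 0"
      by (intro tendsto_real_sqrt summable_LIMSEQ_zero elim)
    moreover have "sqrt (real n powr (- (2 * s)) * V (Y n \<omega>)) = W (Y n \<omega>) / real n powr s" for n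
    proof -
      have "real n powr (- (2 * s)) = (real n powr - s)\<^sup>2"
        by (simp add: power2_eq_square powr_add[symmetric])
      then show ?thesis
        by (simp add: real_sqrt_mult W_def powr_minus divide_inverse)
    qed
    ultimately show ?case by simp
  qed
qed

text \<open>Up to a constant factor this bounds the part of step j that neither is a martingale
  increment nor telescopes: at an adaptation time the jump between two solutions, each of size
  \<open>W\<close> (hence the 2), and at every time the residual of the averaged equation, whose
  horizon is at least j + 1.\<close>

definition block_weight :: "nat \<Rightarrow> 'w \<Rightarrow> real" where
  "block_weight j \<omega> = 2 * (indicator (range (air_time \<beta>)) (Suc j) * W (Y (Suc j) \<omega>)) + W (Y j \<omega>) / real (Suc j)"

lemma block_weight_negligible:
  assumes s: "s > 0" "1 < s * (1 + \<beta>)"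
  shows "AE \<omega> in M. (\<lambda>n. (\<Sum>j<n. block_weight j \<omega>) / real n powr s) \<longlonglongrightarrow> 0"
proof -
  define q where "q = 1 / (1 + \<beta>)"
  \<comment> \<open>An exponent strictly between 1 / (1 + \<beta>) and s: the weighted series
    already converges with t, and the gap to s is spent in \<open>kronecker_nonneg\<close>.\<close>
  define t where "t = (s + q) / 2"
  have "0 < q" "q < s" using s beta_pos by (simp_all add: q_def field_simps)
  then have t: "0 < t" "t < s" "q < t" by (simp_all add: t_def)
  have t': "1 < t * (1 + \<beta>)" using t(3) beta_pos by (simp add: q_def field_simps)
  obtain B where B: "0 \<le> B" "\<And>n. (\<integral>\<^sup>+\<omega>. ennreal (W (Y n \<omega>)) \<partial>M) \<le> ennreal B"
    using W_bounded_expectation by blast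
  let ?w1 = "\<lambda>j. indicator (range (air_time \<beta>)) (Suc j) * real (Suc j) powr - t"
  let ?w2 = "\<lambda>j. real (Suc j) powr (- (1 + t))"
  have "summable ?w1"
    using summable_air_times[OF beta_pos t'] by (subst summable_Suc_iff)
  then have "AE \<omega> in M. summable (\<lambda>j. ?w1 j * W (Y (Suc j) \<omega>))"
    using B W_nonneg measurable_compose[OF Y_measurable W_measurable]
    by (intro AE_summable_of_bounded_expectation) auto
  moreover have "summable ?w2"
    using t by (subst summable_Suc_iff) (simp add: summable_real_powr_iff)
  then have "AE \<omega> in M. summable (\<lambda>j. ?w2 j * W (Y j \<omega>))"
    using B W_nonneg measurable_compose[OF Y_measurable W_measurable]
    by (intro AE_summable_of_bounded_expectation) auto
  ultimately show ?thesis
  proof eventually_elim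
    case (elim \<omega>)
    show ?case
    proof (rule kronecker_nonneg[of _ t])
      show "0 \<le> block_weight j \<omega>" for j
        using W_nonneg by (simp add: block_weight_def)
      have "real (Suc j) powr - t * block_weight j \<omega> = 2 * (?w1 j * W (Y (Suc j) \<omega>)) + ?w2 j * W (Y j \<omega>)" for j
        by (simp add: block_weight_def distrib_left powr_diff mult.assoc mult.commute mult.left_commute
            powr_minus powr_add divide_inverse del: of_nat_Suc)
      then show "summable (\<lambda>j. real (Suc j) powr - t * block_weight j \<omega>)"
        using summable_add[OF summable_mult[OF elim(1), of 2] elim(2)] by simp
    qed (use t in auto)
  qed
qed

lemma strong_law_centred:
  fixes u :: "'x \<times> 'f \<Rightarrow> real"
  assumes u: "u \<in> borel_measurable borel" and u_bound: "\<And>y. \<bar>u y\<bar> \<le> c * W y"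
    and u_centred: "\<And>\<gamma>. \<gamma> \<in> space MI \<Longrightarrow> (\<integral>y. u y \<partial>\<pi> \<gamma>) = 0"
    and s: "s > 1 / 2" "1 < s * (1 + \<beta>)"
  shows "AE \<omega> in M. (\<lambda>n. (\<Sum>j=1..n. u (Y j \<omega>)) / real n powr s) \<longlonglongrightarrow> 0"
proof -
  define K where "K = c * poisson_const (sqrt \<kappa>) (sqrt b) \<delta>"
  define G where "G n \<gamma> y = poisson_avg (P \<gamma>) u (next_air_time \<beta> n) y" for n \<gamma> y
  have G_bound: "\<bar>G n \<gamma> y\<bar> \<le> K * W y"
    and G_equation: "\<bar>u y - (G n \<gamma> y - kernel_op (P \<gamma>) (G n \<gamma>) y)\<bar> \<le> K * W y / real (next_air_time \<beta> n)"
    if \<gamma>: "\<gamma> \<in> space MI" for n \<gamma> y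
  proof -
    obtain \<eta> where "stationary_drift_minorization borel (P \<gamma>) W C (sqrt \<kappa>) (sqrt b) \<delta> \<eta> (\<pi> \<gamma>)"
      using fibre_drift_minorization[OF \<gamma>] .
    then interpret stationary_drift_minorization borel "P \<gamma>" W C "sqrt \<kappa>" "sqrt b" \<delta> \<eta> "\<pi> \<gamma>" .
    show "\<bar>G n \<gamma> y\<bar> \<le> K * W y"
      unfolding G_def K_def using poisson_avg_bound[OF u u_bound u_centred[OF \<gamma>]] by simp
    have "G n \<gamma> = poisson_avg (P \<gamma>) u (next_air_time \<beta> n)" by (simp add: G_def fun_eq_iff)
    then show "\<bar>u y - (G n \<gamma> y - kernel_op (P \<gamma>) (G n \<gamma>) y)\<bar> \<le> K * W y / real (next_air_time \<beta> n)"
      unfolding K_def using poisson_avg_equation[OF u u_bound u_centred[OF \<gamma>], of y "next_air_time \<beta> n"]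
        next_air_time_gt[of n \<beta>] by simp
  qed
  have G_measurable: "(\<lambda>(y, \<gamma>). G n \<gamma> y) \<in> borel_measurable (borel \<Otimes>\<^sub>M MI)" for n
    unfolding G_def poisson_avg_def split_beta'
    using kernel_op_pow_jointly_measurable[OF u, unfolded split_beta']
    by (intro borel_measurable_divide borel_measurable_sum borel_measurable_const)
  have K: "0 \<le> K"
  proof -
    obtain \<omega> where "\<omega> \<in> space M" using not_empty by auto
    from G_bound[OF \<Gamma>_space[OF this, of 0], of 0 undefined] show ?thesis
      using W_ge_1[of undefined] by (smt (verit) mult_neg_pos)
  qed
  \<comment> \<open>Each u (Y j) is an innovation, plus a difference of consecutive values of g
    along the chain, plus the jump \<open>d j\<close>, plus the residual \<open>r j\<close>. The
    terms with c account for the shift from the range j < n to j = 1..n.\<close>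
  have decomposition: "\<bar>\<Sum>j=1..n. u (Y j \<omega>)\<bar>
      \<le> \<bar>\<Sum>j<n. innovation G j \<omega>\<bar> + (K + c) * W (Y 0 \<omega>) + (K + c) * W (Y n \<omega>) + K * (\<Sum>j<n. block_weight j \<omega>)"
    if \<omega>: "\<omega> \<in> space M" for n \<omega>
  proof -
    note \<gamma> = \<Gamma>_space[OF \<omega>]
    define g where "g j = G j (\<Gamma> j \<omega>)" for j
    define r where "r j = u (Y j \<omega>) - (g j (Y j \<omega>) - kernel_op (P (\<Gamma> j \<omega>)) (g j) (Y j \<omega>))" for j
    define d where "d j = g (Suc j) (Y (Suc j) \<omega>) - g j (Y (Suc j) \<omega>)" for j
    have d: "\<bar>d j\<bar> \<le> K * (2 * (indicator (range (air_time \<beta>)) (Suc j) * W (Y (Suc j) \<omega>)))" for j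
    proof (cases "Suc j \<in> range (air_time \<beta>)")
      case True
      then show ?thesis
        using G_bound[OF \<gamma>[of "Suc j"], of "Suc j" "Y (Suc j) \<omega>"] G_bound[OF \<gamma>[of j], of j "Y (Suc j) \<omega>"]
        by (simp add: d_def g_def)
    next
      case False
      \<comment> \<open>Within a block neither the parameter nor the horizon changes, so consecutive
        functions g coincide and there is no jump.\<close>
      obtain m where "j \<in> {air_time \<beta> m..<air_time \<beta> (Suc m)}" "Suc j \<in> {air_time \<beta> m..<air_time \<beta> (Suc m)}"
        using same_block[OF False] .
      then have "\<Gamma> (Suc j) \<omega> = \<Gamma> j \<omega>" using adaptation_times \<omega> by blast
      then show ?thesis
        using False next_air_time_Suc[OF False] by (simp add: d_def g_def G_def)
    qed
    have r: "\<bar>r j\<bar> \<le> K * (W (Y j \<omega>) / real (Suc j))" for j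
    proof -
      have "\<bar>r j\<bar> \<le> K * W (Y j \<omega>) / real (next_air_time \<beta> j)"
        unfolding r_def g_def by (rule G_equation[OF \<gamma>])
      also have "\<dots> \<le> K * W (Y j \<omega>) / real (Suc j)"
        using K W_nonneg next_air_time_gt[of j \<beta>] by (intro divide_left_mono) auto
      finally show ?thesis by simp
    qed
    have "u (Y j \<omega>) = innovation G j \<omega> + (g j (Y j \<omega>) - g (Suc j) (Y (Suc j) \<omega>)) + (d j + r j)" for j
      by (simp add: r_def d_def innovation_def g_def)
    then have "(\<Sum>j<n. u (Y j \<omega>)) = (\<Sum>j<n. innovation G j \<omega>) + (\<Sum>j<n. g j (Y j \<omega>) - g (Suc j) (Y (Suc j) \<omega>)) + (\<Sum>j<n. d j + r j)"
      by (simp add: sum.distrib)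
    also have "(\<Sum>j<n. g j (Y j \<omega>) - g (Suc j) (Y (Suc j) \<omega>)) = g 0 (Y 0 \<omega>) - g n (Y n \<omega>)"
      by (rule sum_lessThan_telescope')
    finally have 1: "(\<Sum>j<n. u (Y j \<omega>)) = (\<Sum>j<n. innovation G j \<omega>) + (g 0 (Y 0 \<omega>) - g n (Y n \<omega>)) + (\<Sum>j<n. d j + r j)" .
    have 2: "\<bar>\<Sum>j<n. d j + r j\<bar> \<le> K * (\<Sum>j<n. block_weight j \<omega>)"
      unfolding sum_distrib_left
    proof (intro order_trans[OF sum_abs] sum_mono)
      fix j
      show "\<bar>d j + r j\<bar> \<le> K * block_weight j \<omega>"
        using d[of j] r[of j] by (simp only: block_weight_def distrib_left)
    qed
    have 3: "\<bar>g 0 (Y 0 \<omega>)\<bar> \<le> K * W (Y 0 \<omega>)" "\<bar>g n (Y n \<omega>)\<bar> \<le> K * W (Y n \<omega>)"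
      unfolding g_def by (rule G_bound[OF \<gamma>])+
    have "(\<Sum>j=1..n. u (Y j \<omega>)) = (\<Sum>j<n. u (Y j \<omega>)) + u (Y n \<omega>) - u (Y 0 \<omega>)"
      using sum.lessThan_Suc[of "\<lambda>j. u (Y j \<omega>)" n] sum.lessThan_Suc_shift[of "\<lambda>j. u (Y j \<omega>)" n]
      by (simp add: sum.atLeast1_atMost_eq)
    then show ?thesis
      using 1 2 3 u_bound[of "Y n \<omega>"] u_bound[of "Y 0 \<omega>"]
      unfolding distrib_right by linarith
  qed
  have s0: "0 < s" using s by simp
  have "AE \<omega> in M. (\<lambda>n. (\<Sum>k<n. innovation G k \<omega>) / real n powr s) \<longlonglongrightarrow> 0"
    by (rule innovation_strong_law[OF G_measurable G_bound s(1)])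
  then show ?thesis
    using AE_space W_negligible[OF s(1)]
      block_weight_negligible[OF s0 s(2)]
  proof eventually_elim
    case (elim \<omega>)
    let ?R = "\<lambda>n. \<bar>(\<Sum>j<n. innovation G j \<omega>) / real n powr s\<bar> + (K + c) * W (Y 0 \<omega>) * real n powr - s
        + (K + c) * (W (Y n \<omega>) / real n powr s) + K * ((\<Sum>j<n. block_weight j \<omega>) / real n powr s)"
    have "?R \<longlonglongrightarrow> \<bar>0\<bar> + (K + c) * W (Y 0 \<omega>) * 0 + (K + c) * 0 + K * 0"
      using s0 by (intro tendsto_add tendsto_mult_left tendsto_rabs elim tendsto_neg_powr filterlim_real_sequentially) auto
    then have "?R \<longlonglongrightarrow> 0" by simp
    then show ?case
    proof (rule Lim_null_comparison[rotated])
      show "\<forall>\<^sub>F n in sequentially. norm ((\<Sum>j=1..n. u (Y j \<omega>)) / real n powr s) \<le> ?R n"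
      proof (rule always_eventually, rule allI)
        fix n
        have "norm ((\<Sum>j=1..n. u (Y j \<omega>)) / real n powr s) = \<bar>\<Sum>j=1..n. u (Y j \<omega>)\<bar> / real n powr s"
          by (simp add: abs_divide)
        also have "\<dots> \<le> (\<bar>\<Sum>j<n. innovation G j \<omega>\<bar> + (K + c) * W (Y 0 \<omega>) + (K + c) * W (Y n \<omega>)
            + K * (\<Sum>j<n. block_weight j \<omega>)) / real n powr s"
          by (intro divide_right_mono decomposition elim) simp
        also have "\<dots> = ?R n"
          by (simp add: abs_mult powr_minus divide_inverse distrib_right mult.assoc)
        finally show "norm ((\<Sum>j=1..n. u (Y j \<omega>)) / real n powr s) \<le> ?R n" .
      qed
    qed
  qed
qed

end

section \<open>Centring by the marginal and reduction to the centred case\<close>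

lemma fst_borel_measurable:
  "fst \<in> (borel :: ('a::second_countable_topology \<times> 'b::second_countable_topology) measure) \<rightarrow>\<^sub>M borel"
  using measurable_fst[of "borel :: 'a measure" "borel :: 'b measure"] by (simp add: borel_prod)

text \<open>A single constant centres the function for every \<gamma>, so the sum keeps its centring
  while the parameter moves.\<close>

lemma (in mcmc_family) integral_marginal:
  fixes f :: "'x \<Rightarrow> real"
  assumes \<gamma>: "\<gamma> \<in> space MI" and f: "f \<in> borel_measurable borel"
  shows "(\<integral>y. f (fst y) \<partial>\<pi> \<gamma>) = (\<integral>x. f x \<partial>\<nu>)"
proof -
  have sets: "sets (\<pi> \<gamma>) = sets borel"
    using invariant[OF \<gamma>] by (simp add: invariant_distribution_def)
  have fst: "fst \<in> \<pi> \<gamma> \<rightarrow>\<^sub>M borel"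
    using fst_borel_measurable sets by (simp cong: measurable_cong_sets)
  have "distr (\<pi> \<gamma>) borel fst = \<nu>"
  proof (rule measure_eqI)
    fix A assume "A \<in> sets (distr (\<pi> \<gamma>) borel fst)"
    then have A: "A \<in> sets borel" by simp
    have "fst -` A \<inter> space (\<pi> \<gamma>) = A \<times> UNIV"
      using sets_eq_imp_space_eq[OF sets] by auto
    then show "emeasure (distr (\<pi> \<gamma>) borel fst) A = emeasure \<nu> A"
      using A fst marginal[OF \<gamma> A] by (simp add: emeasure_distr)
  qed (simp add: sets_nu)
  then show ?thesis using integral_distr[OF fst f] by simp
qed

theorem theorem4p9:
  fixes \<nu> :: "'x::polish_space measure"
    and MI :: "'i measure"
    and \<pi> :: "'i \<Rightarrow> ('x \<times> 'f::polish_space) measure"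
    and P :: "'i \<Rightarrow> 'x \<times> 'f \<Rightarrow> ('x \<times> 'f) measure"
    and \<beta> :: real
    and M :: "'w measure"
    and Y :: "nat \<Rightarrow> 'w \<Rightarrow> 'x \<times> 'f"
    and \<Gamma> :: "nat \<Rightarrow> 'w \<Rightarrow> 'i"
    and C :: "('x \<times> 'f) set"
    and V :: "'x \<times> 'f \<Rightarrow> real"
    and \<kappa> \<delta> b v p \<epsilon> :: real
    and f :: "'x \<Rightarrow> real"
  assumes air: "air_mcmc \<nu> MI \<pi> P \<beta> M Y \<Gamma>"
    and C: "C \<in> sets borel"
    and V_lsc: "lower_semicontinuous V"
    and V_measurable: "V \<in> borel_measurable borel"
    and V_ge_1: "\<And>y. V y \<ge> 1"
    and \<kappa>: "0 < \<kappa>" "\<kappa> < 1"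
    and \<delta>: "\<delta> > 0"
    and V_bounded_on_C: "(SUP y\<in>C. ereal (V y)) = ereal v"
    and drift: "\<And>\<gamma> y. \<gamma> \<in> space MI \<Longrightarrow>
      (\<integral>\<^sup>+ y'. ennreal (V y') \<partial>P \<gamma> y) \<le> ennreal (\<kappa> * V y + b * indicator C y)"
    and minorization: "\<And>\<gamma>. \<gamma> \<in> space MI \<Longrightarrow>
      \<exists>\<eta>. prob_space \<eta> \<and> sets \<eta> = sets (restrict_space borel C) \<and>
        (\<forall>y\<in>C. \<forall>A\<in>sets borel. emeasure (P \<gamma> y) A \<ge> ennreal \<delta> * emeasure \<eta> (A \<inter> C))"
    and p: "p > 2"
    and f_measurable: "f \<in> borel_measurable borel"
    and f_bound: "\<And>x \<phi>. \<bar>f x\<bar> \<le> V (x, \<phi>) powr (1 / p)"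
    and \<epsilon>: "\<epsilon> > max 0 (1 / (1 + \<beta>) + 1 / p - 1 / 2)"
  shows "AE \<omega> in M.
    (\<lambda>n. (\<Sum>j = 1..n. (f (fst (Y j \<omega>)) - (\<integral>x. f x \<partial>\<nu>))) / real n powr (1 / 2 + \<epsilon>)) \<longlonglongrightarrow> 0"
proof -
  interpret air: air_mcmc \<nu> MI \<pi> P \<beta> M Y \<Gamma> by (rule air)
  interpret drifting_air_mcmc \<nu> MI \<pi> P \<beta> M Y \<Gamma> C V \<kappa> "max b 0" \<delta>
  proof
    fix \<gamma> y assume \<gamma>: "\<gamma> \<in> space MI"
    have "ennreal (\<kappa> * V y + b * indicator C y) \<le> ennreal (\<kappa> * V y + max b 0 * indicator C y)"
      by (intro ennreal_leI) (auto simp: indicator_def)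
    with drift[OF \<gamma>]
    show "(\<integral>\<^sup>+ y'. ennreal (V y') \<partial>P \<gamma> y) \<le> ennreal (\<kappa> * V y + max b 0 * indicator C y)"
      by (rule order_trans)
  next
    fix \<gamma> assume "\<gamma> \<in> space MI"
    from minorization[OF this] obtain \<eta> where \<eta>: "prob_space \<eta>" "sets \<eta> = sets (restrict_space borel C)"
      "\<And>y A. y \<in> C \<Longrightarrow> A \<in> sets borel \<Longrightarrow> ennreal \<delta> * emeasure \<eta> (A \<inter> C) \<le> emeasure (P \<gamma> y) A" by blast
    have space: "space \<eta> = C" using sets_eq_imp_space_eq[OF \<eta>(2)] by (simp add: space_restrict_space)
    have id: "(\<lambda>y. y) \<in> \<eta> \<rightarrow>\<^sub>M borel"
    proof -
      have "(\<lambda>y. y) \<in> restrict_space borel C \<rightarrow>\<^sub>M borel" by (rule measurable_restrict_space1) simp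
      then show ?thesis using \<eta>(2) by (simp cong: measurable_cong_sets)
    qed
    show "\<exists>\<eta>. prob_space \<eta> \<and> sets \<eta> = sets borel \<and>
        (\<forall>y\<in>C. \<forall>A\<in>sets borel. ennreal \<delta> * emeasure \<eta> A \<le> emeasure (P \<gamma> y) A)"
    proof (intro exI conjI ballI)
      show "prob_space (distr \<eta> borel (\<lambda>y. y))" using \<eta>(1) id by (rule prob_space.prob_space_distr)
      fix y A assume "y \<in> C" "A \<in> sets (borel :: ('x \<times> 'f) measure)"
      then show "ennreal \<delta> * emeasure (distr \<eta> borel (\<lambda>y. y)) A \<le> emeasure (P \<gamma> y) A"
        using \<eta>(3)[of y A] by (simp add: emeasure_distr[OF id] space vimage_def Int_def)
    qed simp
  qed (use C V_measurable V_ge_1 \<kappa> \<delta> in auto)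
  define m where "m = (\<integral>x. f x \<partial>\<nu>)"
  define u where "u y = f (fst y) - m" for y :: "'x \<times> 'f"
  have h: "(\<lambda>y. f (fst y)) \<in> borel_measurable (borel :: ('x \<times> 'f) measure)"
    by (rule measurable_compose[OF fst_borel_measurable f_measurable])
  have h_bound: "\<bar>f (fst y)\<bar> \<le> W y" for y
  proof -
    have "\<bar>f (fst y)\<bar> \<le> V y powr (1 / p)" using f_bound[of "fst y" "snd y"] by simp
    also have "\<dots> \<le> V y powr (1 / 2)" using p V_ge_1 by (intro powr_mono) (auto simp: field_simps)
    also have "\<dots> = W y" using V_nonneg by (simp add: W_def powr_half_sqrt)
    finally show ?thesis .
  qed
  have s1: "1 / 2 + \<epsilon> > 1 / 2" using \<epsilon> by simp
  \<comment> \<open>This is the condition s (1 + \<beta>) > 1 for s = 1/2 + \<epsilon>, which makes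
    the adaptation times sparse enough; s > 1/2 for the martingale part is \<epsilon> > 0. The
    maximum in the assumption on \<epsilon> yields both.\<close>
  have "1 / 2 + \<epsilon> > 1 / (1 + \<beta>)"
  proof -
    have "0 < 1 / p" using p by simp
    then show ?thesis using \<epsilon> by linarith
  qed
  then have s2: "1 < (1 / 2 + \<epsilon>) * (1 + \<beta>)" using air.beta_pos by (simp add: field_simps)
  have "AE \<omega> in M. (\<lambda>n. (\<Sum>j=1..n. u (Y j \<omega>)) / real n powr (1 / 2 + \<epsilon>)) \<longlonglongrightarrow> 0"
  proof (rule strong_law_centred[OF _ _ _ s1 s2])
    show "u \<in> borel_measurable borel" unfolding u_def using h by simp
    show "\<bar>u y\<bar> \<le> (1 + \<bar>m\<bar>) * W y" for y
    proof -
      have "\<bar>m\<bar> * 1 \<le> \<bar>m\<bar> * W y" using W_ge_1[of y] by (intro mult_left_mono) auto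
      then show ?thesis using h_bound[of y] abs_triangle_ineq4[of "f (fst y)" m]
        unfolding u_def distrib_right by linarith
    qed
    fix \<gamma> assume \<gamma>: "\<gamma> \<in> space MI"
    then interpret \<pi>: prob_space "\<pi> \<gamma>" using air.invariant by (simp add: invariant_distribution_def)
    show "(\<integral>y. u y \<partial>\<pi> \<gamma>) = 0"
      unfolding u_def using integrable_\<pi>[OF \<gamma> h h_bound] air.integral_marginal[OF \<gamma> f_measurable]
      by (simp add: m_def \<pi>.prob_space)
  qed
  then show ?thesis by (simp add: u_def m_def)
qed

end
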